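(* Let $V\in\mathcal V^*$, let $\bar y$ be an initial condition leading to collision for the system $P(0)$ at time $T_0$, let $T>T_0$ (with $T<2T_0$, so that the extended flow is defined), let $y_1=\Phi(\bar y,T)$, and let $\Sigma$ be a hyperplane in the phase space passing through $y_1$ and transversal to the flow. Then there exist $\delta>0$ and a continuous function $\tau(y)$ defined in the $\delta$-neighbourhood $N_\delta(\bar y)$ of $\bar y$ such that $\tau(\bar y)=T$ and $$\Phi(y,\tau(y))\in\Sigma\qquad\text{for all }y\in N_\delta(\bar y).$$ Moreover, the Poincaré section $S(y)=\Phi(y,\tau(y))$ is continuous in $N_\delta(\bar y)$.
   Context: **The classes $\mathcal V$ and $\mathcal V^*$.** $\mathcal V$ is the set of functions $V\in C^\infty(\mathbb R^+,\mathbb R)$, $\mathbb R^+=(0,\infty)$, such that (i) $\lim_{x\to0^+}V(x)=+\infty$; there exists $S\in(0,+\infty]$ such that on $(0,S)$: (ii) $V'(x)<0$ and $V''(x)>0$; (iii) $V'(x)/V''(x)$ is decreasing in $x$; and (iv) $\frac{d}{dx}\frac{V'(x)}{V''(x)}\big|_{x=0}<-\frac12$ (right derivative at $0$ of the function $V'/V''$ extended by continuity to $x=0$). $\mathcal V^*$ is the set of $V\in\mathcal V$ such that (v) $\lim_{\lambda\to0^+}V(\lambda x)/V(\lambda)=1$ for every $x\ge1$, uniformly on every compact $[1,M]$. By (iii), (iv) there is $T_*\in(0,+\infty]$ with $V'(x)/V''(x)\le -x/2$ on $(0,T_* )$. With such $S,T_*$ fixed, $\bar R:=\min\{T_*,S\}$.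 **System and extended flow.** The phase space is $\mathcal F=\{y=(x,\dot x)\in\mathbb R^2\times\mathbb R^2\}$. $P(0)$ is the initial value problem $y'=f(y)$ with $f(x,\dot x)=(\dot x,\nabla V(|x|))$ (gradient with respect to $x\in\mathbb R^2$) and initial position $\ne0$. An initial datum leads to collision at time $T_0$ if the solution of $P(0)$ exists on $[0,T_0)$ and its position tends to $0$ as $t\to T_0^-$. For the datum $\bar y=(\bar q,\bar p)$ it is assumed that $|\bar q|\le\bar R$ and that the position stays in $\{|x|\le\bar R\}$ on $[0,T_0)$. A solution $(\bar x(t),\dot{\bar x}(t))$, $t\in[0,T_0)$, colliding at time $T_0$ is extended past the collision (transmission solution) by $x_0(t)=-\bar x(2T_0-t)$, $\dot x_0(t)=\dot{\bar x}(2T_0-t)$ for $t\in(T_0,2T_0)$. $\Phi(y,t)$ is the flow of $P(0)$, with collision solutions extended in this way. A hyperplane $\Sigma=\{y:(y-y_1)\cdot F=0\}$, $F\in\mathbb R^4$, is transversal to the flow (at $y_1$) if $f(y_1)\cdot F\neq0$. *)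

theory Defs
  imports "HOL-Analysis.Analysis"
begin

section \<open>The classes of potentials\<close>

text \<open>A potential is a total function on the reals; only its values on the positive half-line
  are ever used. There \<open>deriv V\<close> and \<open>deriv (deriv V)\<close> are the ordinary derivatives.\<close>

definition smooth_on_pos :: "(real \<Rightarrow> real) \<Rightarrow> bool" where
  "smooth_on_pos V \<longleftrightarrow> (\<forall>n. \<forall>x>0. (deriv ^^ n) V differentiable (at x))"

definition slope_ratio :: "(real \<Rightarrow> real) \<Rightarrow> real \<Rightarrow> real" where
  "slope_ratio V x = deriv V x / deriv (deriv V) x"

text \<open>Conditions (ii) and (iii) on the interval \<open>(0,S)\<close>, where \<open>S = \<infinity>\<close> is allowed.\<close>

definition convex_decreasing_up_to :: "(real \<Rightarrow> real) \<Rightarrow> ereal \<Rightarrow> bool" where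
  "convex_decreasing_up_to V S \<longleftrightarrow> 0 < S \<and>
     (\<forall>x>0. ereal x < S \<longrightarrow> deriv V x < 0 \<and> deriv (deriv V) x > 0) \<and>
     antimono_on {x. 0 < x \<and> ereal x < S} (slope_ratio V)"

text \<open>Condition (iv): \<open>L\<close> is the value at 0 of the continuous extension of \<open>V'/V''\<close>,
  and \<open>D\<close> is the right derivative at 0 of that extension.\<close>

definition slope_condition :: "(real \<Rightarrow> real) \<Rightarrow> bool" where
  "slope_condition V \<longleftrightarrow>
     (\<exists>L D. (slope_ratio V \<longlongrightarrow> L) (at_right 0) \<and>
        ((\<lambda>x. if x = 0 then L else slope_ratio V x) has_real_derivative D) (at_right 0) \<and>
        D < - 1 / 2)"

definition V_class :: "(real \<Rightarrow> real) set" where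
  "V_class = {V. smooth_on_pos V \<and> filterlim V at_top (at_right 0) \<and>
     (\<exists>S. convex_decreasing_up_to V S) \<and> slope_condition V}"

definition V_star_class :: "(real \<Rightarrow> real) set" where
  "V_star_class = {V \<in> V_class.
     \<forall>M\<ge>1. uniform_limit {1..M} (\<lambda>l x. V (l * x) / V l) (\<lambda>x. 1) (at_right 0)}"

text \<open>The number \<open>T\<^sub>*\<close>, which may be \<open>\<infinity>\<close>.\<close>

definition slope_bound_up_to :: "(real \<Rightarrow> real) \<Rightarrow> ereal \<Rightarrow> bool" where
  "slope_bound_up_to V Tstar \<longleftrightarrow> 0 < Tstar \<and>
     (\<forall>x>0. ereal x < Tstar \<longrightarrow> slope_ratio V x \<le> - x / 2)"


section \<open>The system and its flow\<close>

type_synonym phase = "(real^2) \<times> (real^2)"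

text \<open>The gradient with respect to the position; it exists at every nonzero position.\<close>

definition vector_field :: "(real \<Rightarrow> real) \<Rightarrow> phase \<Rightarrow> phase" where
  "vector_field V y = (snd y, THE g. GDERIV (\<lambda>x. V (norm x)) (fst y) :> g)"

lemma vector_field_eq:
  assumes "smooth_on_pos V" and "fst y \<noteq> 0"
  shows "vector_field V y = (snd y, (deriv V (norm (fst y)) / norm (fst y)) *\<^sub>R fst y)"
proof -
  have "V differentiable (at (norm (fst y)))"
    using assms(1)[unfolded smooth_on_pos_def, rule_format, of "norm (fst y)" 0] assms(2) by simp
  then have "DERIV V (norm (fst y)) :> deriv V (norm (fst y))"
    by (simp add: DERIV_deriv_iff_real_differentiable)
  from GDERIV_DERIV_compose[OF GDERIV_norm[OF assms(2)] this]
  have *: "GDERIV (\<lambda>x. V (norm x)) (fst y) :> deriv V (norm (fst y)) *\<^sub>R sgn (fst y)" .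
  have "g = deriv V (norm (fst y)) *\<^sub>R sgn (fst y)"
    if "GDERIV (\<lambda>x. V (norm x)) (fst y) :> g" for g
  proof -
    have "(\<lambda>h. inner h g) = (\<lambda>h. inner h (deriv V (norm (fst y)) *\<^sub>R sgn (fst y)))"
      by (rule has_derivative_unique[OF that[unfolded gderiv_def] *[unfolded gderiv_def]])
    then have "\<forall>h. inner h g = inner h (deriv V (norm (fst y)) *\<^sub>R sgn (fst y))"
      by (intro allI) (erule fun_cong)
    then show ?thesis
      by (rule vector_eq_ldot[THEN iffD1])
  qed
  with * have "(THE g. GDERIV (\<lambda>x. V (norm x)) (fst y) :> g)
      = deriv V (norm (fst y)) *\<^sub>R sgn (fst y)"
    by (rule the_equality)
  then show ?thesis
    by (simp add: vector_field_def sgn_div_norm divide_inverse)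
qed

text \<open>A solution on \<open>[0,b)\<close> must avoid the singular position 0 throughout.\<close>

definition solution_on :: "(real \<Rightarrow> real) \<Rightarrow> phase \<Rightarrow> real \<Rightarrow> (real \<Rightarrow> phase) \<Rightarrow> bool" where
  "solution_on V y b \<phi> \<longleftrightarrow> 0 < b \<and> \<phi> 0 = y \<and>
     (\<forall>t\<in>{0..<b}. fst (\<phi> t) \<noteq> 0 \<and>
        (\<phi> has_vector_derivative vector_field V (\<phi> t)) (at t within {0..<b}))"

definition collision_solution :: "(real \<Rightarrow> real) \<Rightarrow> phase \<Rightarrow> real \<Rightarrow> (real \<Rightarrow> phase) \<Rightarrow> bool" where
  "collision_solution V y T0 \<phi> \<longleftrightarrow>
     solution_on V y T0 \<phi> \<and> ((\<lambda>t. fst (\<phi> t)) \<longlongrightarrow> 0) (at_left T0)"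

definition leads_to_collision :: "(real \<Rightarrow> real) \<Rightarrow> phase \<Rightarrow> real \<Rightarrow> bool" where
  "leads_to_collision V y T0 \<longleftrightarrow> (\<exists>\<phi>. collision_solution V y T0 \<phi>)"

definition transmission :: "real \<Rightarrow> (real \<Rightarrow> phase) \<Rightarrow> real \<Rightarrow> phase" where
  "transmission T0 \<phi> t = (- fst (\<phi> (2 * T0 - t)), snd (\<phi> (2 * T0 - t)))"

text \<open>The state \<open>z\<close> is reached from \<open>y\<close> at time \<open>t\<close>, either along a regular solution or along
  the transmission extension of a collision solution. No state is reached at the collision time
  itself, where the velocity is unbounded.\<close>

definition flow_reaches :: "(real \<Rightarrow> real) \<Rightarrow> phase \<Rightarrow> real \<Rightarrow> phase \<Rightarrow> bool" where
  "flow_reaches V y t z \<longleftrightarrow>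
     (\<exists>b \<phi>. solution_on V y b \<phi> \<and> 0 \<le> t \<and> t < b \<and> z = \<phi> t) \<or>
     (\<exists>T0 \<phi>. collision_solution V y T0 \<phi> \<and> T0 < t \<and> t < 2 * T0 \<and> z = transmission T0 \<phi> t)"

text \<open>The extended flow \<open>\<Phi>(y,t)\<close> is partial: \<open>Phi\<close> is meaningful on \<open>flow_domain\<close> only.\<close>

definition flow_domain :: "(real \<Rightarrow> real) \<Rightarrow> (phase \<times> real) set" where
  "flow_domain V = {(y, t). \<exists>!z. flow_reaches V y t z}"

definition Phi :: "(real \<Rightarrow> real) \<Rightarrow> phase \<Rightarrow> real \<Rightarrow> phase" where
  "Phi V y t = (THE z. flow_reaches V y t z)"

definition hyperplane :: "phase \<Rightarrow> phase \<Rightarrow> phase set" where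
  "hyperplane y1 F = {y. (y - y1) \<bullet> F = 0}"

definition transversal_at :: "(real \<Rightarrow> real) \<Rightarrow> phase \<Rightarrow> phase \<Rightarrow> bool" where
  "transversal_at V y1 F \<longleftrightarrow> vector_field V y1 \<bullet> F \<noteq> 0"

end

theory Submission
  imports Defs
begin

text \<open>Past a pericenter at time \<open>p\<close> an orbit is the time-reversed mirror image of its incoming part,
  \<open>x(p + s) = R x(p - s)\<close> with \<open>R\<close> the reflection in the apsidal axis \<open>e\<close>; past a collision the transmission
  extension has the same form with \<open>R = -1\<close>. So the extended flow is continuous at a collision orbit
  as soon as, for nearby orbits, the time \<open>p\<close> is close to \<open>T0\<close> and \<open>e\<close> is nearly orthogonal to the line of
  the collision orbit. The first follows from the virial identity, which makes \<open>x \<bullet> v\<close> grow at a definite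
  rate. For the second, convexity and slow variation of \<open>V\<close> give \<open>r V'(r) = o(V(r))\<close>, so that the direction
  of the velocity hardly turns before the pericenter, where it is orthogonal to \<open>e\<close>. Once the extended
  flow is jointly continuous and differentiable in time, the crossing time \<open>\<tau>\<close> comes from the
  intermediate value theorem, as transversality makes the signed distance to the hyperplane strictly monotone.\<close>


section \<open>Globally Lipschitz differential equations\<close>

text \<open>The obstacle is that the velocity is unbounded at a collision, so no Gronwall estimate
  can be carried through the encounter. The mirror symmetry avoids integrating through it: the state
  at time t after the encounter is an explicit image of the state at the earlier time 2p - t, where
  ordinary continuous dependence holds, and only the two parameters p and e remain to be controlled.
  The map built from e does not approach the transmission map as an operator; the two nearly agree
  only on states whose position and velocity both lie on a line almost orthogonal to e. This
  suffices because a collision orbit is rectilinear: r^2 |v|^2 tends to 0 along it, so its conserved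
  angular momentum vanishes. Near a collision datum there may be data of both kinds, some colliding
  themselves and some turning at a pericenter, with slightly different energies; every estimate near
  the center is therefore uniform over energies bounded below, and both kinds are described by one
  statement, with e = 0 standing for a collision.\<close>

text \<open>The weight \<open>exp (-2 * K * t)\<close> makes the Picard operator a contraction on the whole half-line.\<close>

lemma global_solution_exists:
  fixes g :: "'a::banach \<Rightarrow> 'a"
  assumes K: "K > 0" and lip: "\<And>x z. norm (g x - g z) \<le> K * norm (x - z)"
  obtains \<gamma> where "\<gamma> 0 = y" "\<And>t. 0 \<le> t \<Longrightarrow> (\<gamma> has_vector_derivative g (\<gamma> t)) (at t within {0..})"
proof -
  have contg: "continuous_on UNIV g"
    by (rule lipschitz_on_continuous_on[of K]) (use K lip in \<open>auto simp: lipschitz_on_def dist_norm\<close>)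
  define J where "J u t = integral {0..t} (\<lambda>s. g (exp (2 * K * s) *\<^sub>R u s))" for u :: "real \<Rightarrow> 'a" and t :: real
  \<comment> \<open>Here \<open>u\<close> is the sought solution divided by
    \<open>exp (2 * K * t)\<close>. With \<open>max 0 t\<close> the image is continued to negative
    times by its value at 0, so that the operator acts on bounded continuous functions of the whole
    line.\<close>
  define Q where "Q u t = exp (-2 * K * max 0 t) *\<^sub>R (y + J u (max 0 t))" for u and t :: real
  have contint: "continuous_on A (\<lambda>s. g (exp (2 * K * s) *\<^sub>R u s))" if "continuous_on UNIV u" for u A
    by (rule continuous_on_compose2[OF contg]) (use that in \<open>auto intro!: continuous_intros continuous_on_subset[OF that]\<close>)
  have expint: "((\<lambda>s. c * exp (2 * K * s)) has_integral c * (exp (2 * K * t) - 1) / (2*K)) {0..t}" if "t \<ge> 0" for t c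
  proof -
    have "((\<lambda>s. c * exp (2 * K * s)) has_integral (c * exp (2 * K * t) / (2*K) - c * exp (2 * K * 0) / (2*K))) {0..t}"
      by (rule fundamental_theorem_of_calculus[OF that])
        (use K in \<open>auto intro!: derivative_eq_intros simp: has_real_derivative_iff_has_vector_derivative[symmetric]\<close>)
    then show ?thesis by (simp add: algebra_simps diff_divide_distrib)
  qed
  have contJ: "continuous_on {0..} (J u)" if "continuous_on UNIV u" for u
  proof -
    have "continuous (at t within {0..}) (J u)" if "t \<ge> 0" for t
    proof -
      have "continuous_on {0..t+1} (J u)" unfolding J_def
        by (rule indefinite_integral_continuous_1) (intro integrable_continuous_interval contint \<open>continuous_on UNIV u\<close>)
      then have "continuous (at t within {0..t+1}) (J u)"
        using that by (auto simp: continuous_on_eq_continuous_within)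
      moreover have "at t within {0..t+1} = at t within {0..}"
        by (rule at_within_nhd[of _ "{..<t+1}"]) auto
      ultimately show ?thesis by simp
    qed
    then show ?thesis by (auto simp: continuous_on_eq_continuous_within)
  qed
  have Jbound: "norm (J u t) \<le> c / (2*K) * exp (2 * K * t)"
    if "continuous_on UNIV u" "t \<ge> 0" "c \<ge> 0" "\<And>s. s \<ge> 0 \<Longrightarrow> norm (g (exp (2 * K * s) *\<^sub>R u s)) \<le> c * exp (2 * K * s)" for u t c
  proof -
    have "norm (J u t) \<le> c * (exp (2 * K * t) - 1) / (2*K)"
      unfolding J_def integral_unique[OF expint[OF that(2)], symmetric] using that(4)
      by (intro integral_norm_bound_integral integrable_continuous_interval contint that(1)
          has_integral_integrable[OF expint[OF that(2)]]) auto
    also have "\<dots> \<le> c / (2*K) * exp (2 * K * t)" using K that(3) by (auto simp: field_simps)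
    finally show ?thesis .
  qed
  have Qb: "Q (apply_bcontfun u) \<in> bcontfun" for u :: "real \<Rightarrow>\<^sub>C 'a"
  proof -
    have cu: "continuous_on UNIV (apply_bcontfun u)" by auto
    obtain B where B: "\<And>s. norm (apply_bcontfun u s) \<le> B"
      using norm_bounded by blast
    have B0: "B \<ge> 0" using B[of 0] norm_ge_zero order_trans by blast
    define c where "c = norm (g 0) + K * B"
    have c0: "c \<ge> 0" using K B0 by (auto simp: c_def)
    have gb: "norm (g (exp (2 * K * s) *\<^sub>R u s)) \<le> c * exp (2 * K * s)" if "s \<ge> 0" for s
    proof -
      have "norm (g (exp (2 * K * s) *\<^sub>R u s)) \<le> norm (g 0) + norm (g (exp (2 * K * s) *\<^sub>R u s) - g 0)"
        by (metis add.commute norm_triangle_sub)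
      also have "\<dots> \<le> norm (g 0) + K * (exp (2 * K * s) * norm (u s))"
        using lip[of "exp (2 * K * s) *\<^sub>R u s" 0] by auto
      also have "\<dots> \<le> norm (g 0) * exp (2 * K * s) + K * (exp (2 * K * s) * B)"
        using B[of s] K that by (intro add_mono mult_left_mono) (auto simp: mult_le_cancel_left1)
      finally show ?thesis by (simp add: c_def algebra_simps)
    qed
    have "continuous_on UNIV (Q (apply_bcontfun u))" unfolding Q_def
      by (intro continuous_intros continuous_on_compose2[OF contJ[OF cu]]) auto
    moreover have "norm (Q (apply_bcontfun u) t) \<le> norm y + c / (2*K)" for t
    proof -
      let ?t = "max 0 t"
      have "norm (Q (apply_bcontfun u) t) \<le> exp (-2 * K * ?t) * (norm y + c / (2*K) * exp (2 * K * ?t))"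
        unfolding Q_def norm_scaleR
        by (intro mult_mono order_trans[OF norm_triangle_ineq] add_mono Jbound[OF cu _ c0 gb]) auto
      also have "\<dots> = exp (-2 * K * ?t) * norm y + c / (2*K)"
        by (simp add: algebra_simps exp_minus)
      also have "\<dots> \<le> norm y + c / (2*K)"
        using K by (auto intro!: mult_left_le_one_le)
      finally show ?thesis .
    qed
    ultimately show ?thesis by (auto simp: bcontfun_def bounded_iff)
  qed
  define P where "P u = Bcontfun (Q (apply_bcontfun u))" for u :: "real \<Rightarrow>\<^sub>C 'a"
  have Papp: "apply_bcontfun (P u) = Q (apply_bcontfun u)" for u
    unfolding P_def using Qb by (simp add: Bcontfun_inverse)
  \<comment> \<open>Integrating the Lipschitz bound \<open>K * exp (2 * K * s)\<close> produces the
    factor \<open>K / (2 * K)\<close>, which is the contraction constant 1/2.\<close>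
  have contr: "dist (P u) (P w) \<le> 1/2 * dist u w" for u w
  proof (rule dist_bound)
    fix t :: real
    let ?t = "max 0 t"
    have cu: "continuous_on UNIV (apply_bcontfun u)" "continuous_on UNIV (apply_bcontfun w)" by auto
    have bd: "norm (g (exp (2 * K * s) *\<^sub>R apply_bcontfun u s) - g (exp (2 * K * s) *\<^sub>R apply_bcontfun w s)) \<le> (K * dist u w) * exp (2 * K * s)" for s
    proof -
      have "norm (g (exp (2 * K * s) *\<^sub>R apply_bcontfun u s) - g (exp (2 * K * s) *\<^sub>R apply_bcontfun w s)) \<le> K * (exp (2 * K * s) * dist (apply_bcontfun u s) (apply_bcontfun w s))"
        using lip[of "exp (2 * K * s) *\<^sub>R apply_bcontfun u s" "exp (2 * K * s) *\<^sub>R apply_bcontfun w s"]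
        by (simp add: dist_norm flip: scaleR_diff_right)
      also have "\<dots> \<le> K * (exp (2 * K * s) * dist u w)" using K by (intro mult_left_mono dist_bounded) auto
      finally show ?thesis by (simp add: algebra_simps)
    qed
    have "J (apply_bcontfun u) ?t - J (apply_bcontfun w) ?t = integral {0..?t} (\<lambda>s. g (exp (2 * K * s) *\<^sub>R apply_bcontfun u s) - g (exp (2 * K * s) *\<^sub>R apply_bcontfun w s))"
      unfolding J_def by (intro integral_diff[symmetric] integrable_continuous_interval contint cu)
    also have "norm \<dots> \<le> (K * dist u w) * (exp (2 * K * ?t) - 1) / (2*K)"
      unfolding integral_unique[OF expint[OF max.cobounded1], symmetric] using bd
      by (intro integral_norm_bound_integral integrable_continuous_interval continuous_on_diff contint cu
          has_integral_integrable[OF expint]) auto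
    also have "\<dots> \<le> 1/2 * dist u w * exp (2 * K * ?t)" using K by (auto simp: field_simps)
    finally have "exp (-2 * K * ?t) * norm (J (apply_bcontfun u) ?t - J (apply_bcontfun w) ?t) \<le> exp (-2 * K * ?t) * (1/2 * dist u w * exp (2 * K * ?t))"
      by (intro mult_left_mono) auto
    also have "\<dots> = 1/2 * dist u w" by (simp add: exp_minus)
    finally have le: "exp (-2 * K * ?t) * norm (J (apply_bcontfun u) ?t - J (apply_bcontfun w) ?t) \<le> 1/2 * dist u w" .
    have "P u t - P w t = exp (-2 * K * ?t) *\<^sub>R (J (apply_bcontfun u) ?t - J (apply_bcontfun w) ?t)"
      by (simp add: Papp Q_def algebra_simps)
    then show "dist (P u t) (P w t) \<le> 1/2 * dist u w"
      using le by (simp add: dist_norm)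
  qed
  obtain u where u: "P u = u"
    using banach_fix_type[of "1/2" P] contr by auto
  define \<gamma> where "\<gamma> t = exp (2 * K * t) *\<^sub>R apply_bcontfun u t" for t
  have cu: "continuous_on UNIV (apply_bcontfun u)" by auto
  have g_eq: "\<gamma> t = y + integral {0..t} (\<lambda>s. g (\<gamma> s))" if "t \<ge> 0" for t
  proof -
    have "apply_bcontfun u t = Q (apply_bcontfun u) t" by (metis Papp u)
    then show ?thesis using that by (simp add: \<gamma>_def Q_def J_def exp_minus)
  qed
  have contg\<gamma>: "continuous_on A (\<lambda>s. g (\<gamma> s))" for A unfolding \<gamma>_def by (rule contint[OF cu])
  show ?thesis
  proof
    show "\<gamma> 0 = y" using g_eq[of 0] by simp
    fix t :: real assume t: "0 \<le> t"
    have "((\<lambda>t. integral {0..t} (\<lambda>s. g (\<gamma> s))) has_vector_derivative g (\<gamma> t)) (at t within {0..t+1})"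
      by (rule integral_has_vector_derivative[OF contg\<gamma>]) (use t in auto)
    then have "((\<lambda>t. y + integral {0..t} (\<lambda>s. g (\<gamma> s))) has_vector_derivative g (\<gamma> t)) (at t within {0..t+1})"
      by (rule has_vector_derivative_add[OF has_vector_derivative_const, simplified])
    then have "(\<gamma> has_vector_derivative g (\<gamma> t)) (at t within {0..t+1})"
      by (rule has_vector_derivative_transform[rotated -1]) (use t g_eq in auto)
    moreover have "at t within {0..t+1} = at t within {0..}"
      by (rule at_within_nhd[of _ "{..<t+1}"]) auto
    ultimately show "(\<gamma> has_vector_derivative g (\<gamma> t)) (at t within {0..})" by simp
  qed
qed

text \<open>The squared distance weighted by \<open>exp (-2 * K * t)\<close> has a nonpositive
  derivative, by Cauchy-Schwarz and the Lipschitz bound. Squaring keeps the function differentiable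
  where the two curves meet.\<close>

lemma gronwall_Lipschitz:
  fixes g :: "'a::real_inner \<Rightarrow> 'a"
  assumes lip: "\<And>x z. norm (g x - g z) \<le> K * norm (x - z)"
    and x: "\<And>t. t \<in> {0..b} \<Longrightarrow> (x has_vector_derivative g (x t)) (at t within {0..b})"
    and z: "\<And>t. t \<in> {0..b} \<Longrightarrow> (z has_vector_derivative g (z t)) (at t within {0..b})"
    and t: "t \<in> {0..b}"
  shows "norm (x t - z t) \<le> exp (K * t) * norm (x 0 - z 0)"
proof -
  define N where "N t = exp (-2 * K * t) * ((x t - z t) \<bullet> (x t - z t))" for t
  have der: "(N has_real_derivative
       exp (-2 * K * t) * (2 * ((x t - z t) \<bullet> (g (x t) - g (z t)))) - 2*K * exp (-2 * K * t) * ((x t - z t) \<bullet> (x t - z t)))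
     (at t within {0..b})" if "t \<in> {0..b}" for t
  proof -
    have d: "((\<lambda>t. x t - z t) has_derivative (\<lambda>h. h *\<^sub>R (g (x t) - g (z t)))) (at t within {0..b})"
      using has_vector_derivative_diff[OF x[OF that] z[OF that]] by (simp add: has_vector_derivative_def)
    have *: "((\<lambda>t. (x t - z t) \<bullet> (x t - z t)) has_real_derivative 2 * ((x t - z t) \<bullet> (g (x t) - g (z t)))) (at t within {0..b})"
      unfolding has_field_derivative_def
      by (rule has_derivative_eq_rhs[OF has_derivative_inner[OF d d]]) (auto simp: fun_eq_iff inner_commute)
    have e: "((\<lambda>t. exp (-2 * K * t)) has_real_derivative - 2*K * exp (-2 * K * t)) (at t within {0..b})"
      by (auto intro!: derivative_eq_intros)
    show ?thesis unfolding N_def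
      by (rule DERIV_cong[OF DERIV_mult[OF e *]]) (simp add: algebra_simps)
  qed
  have "N t \<le> N 0"
  proof (rule DERIV_nonpos_imp_decreasing_open[of 0 t N])
    show "0 \<le> t" using t by auto
    show "continuous_on {0..t} N"
    proof (rule DERIV_continuous_on)
      fix s assume "s \<in> {0..t}"
      then show "(N has_real_derivative
       exp (-2 * K * s) * (2 * ((x s - z s) \<bullet> (g (x s) - g (z s)))) - 2 * K * exp (-2 * K * s) * ((x s - z s) \<bullet> (x s - z s)))
       (at s within {0..t})" using t by (intro DERIV_subset[OF der]) auto
    qed
    fix s assume s: "0 < s" "s < t"
    have "at s within {0..b} = at s" by (rule at_within_interior) (use s t in auto)
    with der[of s] have "(N has_real_derivative
       exp (-2 * K * s) * (2 * ((x s - z s) \<bullet> (g (x s) - g (z s)))) - 2*K * exp (-2 * K * s) * ((x s - z s) \<bullet> (x s - z s)))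
     (at s)" using s t by auto
    moreover have "(x s - z s) \<bullet> (g (x s) - g (z s)) \<le> K * ((x s - z s) \<bullet> (x s - z s))"
    proof -
      have "(x s - z s) \<bullet> (g (x s) - g (z s)) \<le> norm (x s - z s) * norm (g (x s) - g (z s))"
        by (rule norm_cauchy_schwarz)
      also have "\<dots> \<le> norm (x s - z s) * (K * norm (x s - z s))" by (intro mult_left_mono lip) auto
      finally show ?thesis by (simp add: dot_square_norm power2_eq_square algebra_simps)
    qed
    then have "exp (-2 * K * s) * (2 * ((x s - z s) \<bullet> (g (x s) - g (z s))))
        \<le> exp (-2 * K * s) * (2 * (K * ((x s - z s) \<bullet> (x s - z s))))"
      by (intro mult_left_mono) auto
    then have "exp (-2 * K * s) * (2 * ((x s - z s) \<bullet> (g (x s) - g (z s))))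
        - 2 * K * exp (-2 * K * s) * ((x s - z s) \<bullet> (x s - z s)) \<le> 0"
      by (simp only: mult_ac diff_le_0_iff_le)
    ultimately show "\<exists>D. DERIV N s :> D \<and> D \<le> 0" by blast
  qed
  then have "(norm (x t - z t))\<^sup>2 \<le> exp (2 * K * t) * (norm (x 0 - z 0))\<^sup>2"
    by (simp add: N_def exp_minus field_simps dot_square_norm)
  also have "\<dots> = (exp (K * t) * norm (x 0 - z 0))\<^sup>2"
    by (simp add: power_mult_distrib power2_eq_square mult_exp_exp)
  finally show ?thesis by (rule power2_le_imp_le) auto
qed

section \<open>Uniqueness, continuous dependence and continuation of solutions\<close>

lemma norm_fst_diff_le: "norm (fst p - fst q) \<le> norm (p - q)"
  using norm_fst_le[of "fst (p - q)" "snd (p - q)"] unfolding prod.collapse by simp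

lemma norm_snd_diff_le: "norm (snd p - snd q) \<le> norm (p - q)"
  using norm_snd_le[of "snd (p - q)" "fst (p - q)"] unfolding prod.collapse by simp

locale smooth_potential =
  fixes V :: "real \<Rightarrow> real"
  assumes smooth: "smooth_on_pos V"
begin

lemma V_has_deriv: "x > 0 \<Longrightarrow> (V has_real_derivative deriv V x) (at x)"
  using smooth[unfolded smooth_on_pos_def, rule_format, of x 0]
  by (simp add: DERIV_deriv_iff_real_differentiable)

lemma V'_has_deriv: "x > 0 \<Longrightarrow> (deriv V has_real_derivative deriv (deriv V) x) (at x)"
  using smooth[unfolded smooth_on_pos_def, rule_format, of x 1]
  by (simp add: DERIV_deriv_iff_real_differentiable)

lemma isCont_V'': "x > 0 \<Longrightarrow> isCont (deriv (deriv V)) x"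
  using smooth[unfolded smooth_on_pos_def, rule_format, of x 2]
  by (intro differentiable_imp_continuous_within) (simp add: eval_nat_numeral)

text \<open>The vector field with the radius in the force coefficient clamped to \<open>[\<epsilon>, M]\<close>, so that it is globally Lipschitz.\<close>

definition reg_field :: "real \<Rightarrow> real \<Rightarrow> phase \<Rightarrow> phase" where
  "reg_field \<epsilon> M y = (let c = max \<epsilon> (min M (norm (fst y))) in (snd y, (deriv V c / c) *\<^sub>R fst y))"

lemma reg_field_eq_vector_field:
  assumes "0 < \<epsilon>" "\<epsilon> \<le> norm (fst y)" "norm (fst y) \<le> M"
  shows "reg_field \<epsilon> M y = vector_field V y"
proof -
  have "fst y \<noteq> 0" using assms by auto
  moreover have "max \<epsilon> (min M (norm (fst y))) = norm (fst y)" using assms by auto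
  ultimately show ?thesis by (simp add: reg_field_def Let_def vector_field_eq[OF smooth])
qed

text \<open>On the compact interval of clamped radii the coefficient \<open>V'(r)/r\<close> is
  bounded with bounded derivative, and clamping the radius is 1-Lipschitz in the position.\<close>

lemma reg_field_Lipschitz:
  assumes "0 < \<epsilon>" "\<epsilon> \<le> M"
  obtains K where "K > 0" "\<And>y z. norm (reg_field \<epsilon> M y - reg_field \<epsilon> M z) \<le> K * norm (y - z)"
proof -
  define h where "h r = deriv V r / r" for r
  define h' where "h' r = (deriv (deriv V) r * r - deriv V r) / (r * r)" for r
  have dh: "(h has_real_derivative h' r) (at r within {\<epsilon>..M})" if "r \<in> {\<epsilon>..M}" for r
    unfolding h_def h'_def using that assms V'_has_deriv[of r]
    by (auto intro!: derivative_eq_intros intro: has_field_derivative_at_within)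
  have cont_h': "continuous_on {\<epsilon>..M} h'"
    unfolding h'_def using assms
    by (intro continuous_intros continuous_at_imp_continuous_on ballI isCont_V'' DERIV_isCont[OF V'_has_deriv]) auto
  have "bounded (h' ` {\<epsilon>..M})" "bounded (h ` {\<epsilon>..M})"
    using cont_h' DERIV_continuous_on[OF dh] by (auto intro!: compact_imp_bounded compact_continuous_image)
  then obtain L B where "\<forall>z\<in>h' ` {\<epsilon>..M}. norm z \<le> L" and "\<forall>z\<in>h ` {\<epsilon>..M}. norm z \<le> B"
    unfolding bounded_iff by blast
  then have L: "\<And>r. r \<in> {\<epsilon>..M} \<Longrightarrow> \<bar>h' r\<bar> \<le> L" and B: "\<And>r. r \<in> {\<epsilon>..M} \<Longrightarrow> \<bar>h r\<bar> \<le> B"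
    by auto
  have L0: "L \<ge> 0" and B0: "B \<ge> 0" using L[of \<epsilon>] B[of \<epsilon>] assms by auto
  have hL: "\<bar>h r - h s\<bar> \<le> L * \<bar>r - s\<bar>" if "r \<in> {\<epsilon>..M}" "s \<in> {\<epsilon>..M}" for r s
    using field_differentiable_bound[of "{\<epsilon>..M}" h h' L r s] dh L that by (auto simp: abs_minus_commute)
  define c where "c a = max \<epsilon> (min M (norm a))" for a :: "real^2"
  have c: "c a \<in> {\<epsilon>..M}" for a using assms by (auto simp: c_def)
  have c_lip: "\<bar>c a - c b\<bar> \<le> norm (a - b)" for a b
    using norm_triangle_ineq3[of a b] by (auto simp: c_def max_def min_def)
  \<comment> \<open>The variation of the coefficient is multiplied by one of the positions, which
    must be bounded. By symmetry either position may be that one; if both lie beyond radius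
    \<open>M\<close>, the coefficient is constant.\<close>
  have *: "norm (h (c a) *\<^sub>R a - h (c b) *\<^sub>R b) \<le> (B + L * M) * norm (a - b)" if "norm b \<le> M" for a b
  proof -
    have "h (c a) *\<^sub>R a - h (c b) *\<^sub>R b = h (c a) *\<^sub>R (a - b) + (h (c a) - h (c b)) *\<^sub>R b"
      by (simp add: algebra_simps)
    also have "norm \<dots> \<le> \<bar>h (c a)\<bar> * norm (a - b) + \<bar>h (c a) - h (c b)\<bar> * norm b"
      by (rule order_trans[OF norm_triangle_ineq]) simp
    also have "\<dots> \<le> B * norm (a - b) + (L * norm (a - b)) * M"
      using L0 B0 c_lip[of a b] that
      by (intro add_mono mult_mono B c order_trans[OF hL[OF c c]] mult_nonneg_nonneg mult_left_mono) auto
    finally show ?thesis by (simp add: algebra_simps)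
  qed
  have **: "norm (h (c a) *\<^sub>R a - h (c b) *\<^sub>R b) \<le> (B + L * M) * norm (a - b)" for a b
  proof -
    consider "norm b \<le> M" | "norm a \<le> M" | "norm a > M" "norm b > M" by linarith
    then show ?thesis
    proof cases
      case 1 then show ?thesis by (rule *)
    next
      case 2 then show ?thesis using *[of a b] by (simp add: norm_minus_commute)
    next
      case 3
      then have "c a = M" "c b = M" using assms by (auto simp: c_def)
      then have "norm (h (c a) *\<^sub>R a - h (c b) *\<^sub>R b) = \<bar>h M\<bar> * norm (a - b)"
        by (simp flip: scaleR_diff_right)
      also have "\<dots> \<le> (B + L * M) * norm (a - b)"
        using B[of M] mult_nonneg_nonneg[OF L0, of M] assms by (intro mult_right_mono) auto
      finally show ?thesis .
    qed
  qed
  show ?thesis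
  proof (rule that[of "1 + (B + L * M)"])
    have BL: "B + L * M \<ge> 0" using B0 L0 assms by simp
    then show "1 + (B + L * M) > 0" by simp
    fix y z :: phase
    have "norm (reg_field \<epsilon> M y - reg_field \<epsilon> M z)
        = norm (snd y - snd z, h (c (fst y)) *\<^sub>R fst y - h (c (fst z)) *\<^sub>R fst z)"
      by (simp add: reg_field_def h_def c_def Let_def)
    also have "\<dots> \<le> norm (snd y - snd z) + norm (h (c (fst y)) *\<^sub>R fst y - h (c (fst z)) *\<^sub>R fst z)"
      by (rule norm_Pair_le)
    also have "\<dots> \<le> norm (y - z) + (B + L * M) * norm (y - z)"
      using BL by (intro add_mono order_trans[OF **] mult_left_mono norm_fst_diff_le norm_snd_diff_le)
    finally show "norm (reg_field \<epsilon> M y - reg_field \<epsilon> M z) \<le> (1 + (B + L * M)) * norm (y - z)"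
      by (simp add: algebra_simps)
  qed
qed

lemma continuous_on_vector_field: "continuous_on {y. fst y \<noteq> 0} (vector_field V)"
proof -
  have "continuous_on {0<..} (deriv V)"
    by (intro continuous_at_imp_continuous_on ballI DERIV_isCont[OF V'_has_deriv]) simp
  then have V': "continuous_on {y. fst y \<noteq> 0} (\<lambda>y::phase. deriv V (norm (fst y)))"
    by (rule continuous_on_compose2) (auto intro!: continuous_intros)
  have "continuous_on {y. fst y \<noteq> 0} (\<lambda>y::phase. (snd y, (deriv V (norm (fst y)) / norm (fst y)) *\<^sub>R fst y))"
    by (intro continuous_intros V') auto
  then show ?thesis
    by (rule continuous_on_eq) (simp add: vector_field_eq[OF smooth])
qed

lemma solution_onD:
  assumes "solution_on V y b \<phi>"
  shows "0 < b" "\<phi> 0 = y" "\<And>t. 0 \<le> t \<Longrightarrow> t < b \<Longrightarrow> fst (\<phi> t) \<noteq> 0"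
    "\<And>t. 0 \<le> t \<Longrightarrow> t < b \<Longrightarrow> (\<phi> has_vector_derivative vector_field V (\<phi> t)) (at t within {0..<b})"
    "\<And>t. 0 < t \<Longrightarrow> t < b \<Longrightarrow> (\<phi> has_vector_derivative vector_field V (\<phi> t)) (at t)"
    "continuous_on {0..<b} \<phi>"
proof -
  show 1: "0 < b" "\<phi> 0 = y" "\<And>t. 0 \<le> t \<Longrightarrow> t < b \<Longrightarrow> fst (\<phi> t) \<noteq> 0"
    "\<And>t. 0 \<le> t \<Longrightarrow> t < b \<Longrightarrow> (\<phi> has_vector_derivative vector_field V (\<phi> t)) (at t within {0..<b})"
    using assms by (auto simp: solution_on_def)
  show "(\<phi> has_vector_derivative vector_field V (\<phi> t)) (at t)" if "0 < t" "t < b" for t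
    using 1(4)[of t] that by (simp add: at_within_interior[of t "{0..<b}"])
  show "continuous_on {0..<b} \<phi>"
    using 1(4) by (auto simp: continuous_on_eq_continuous_within intro!: has_vector_derivative_continuous)
qed

lemma solution_on_subset:
  assumes "solution_on V y b \<phi>" "0 < c" "c \<le> b"
  shows "solution_on V y c \<phi>"
  using assms unfolding solution_on_def
  by (auto intro!: has_vector_derivative_within_subset[of \<phi> _ _ "{0..<b}" "{0..<c}"])

lemma solution_on_cong:
  assumes "solution_on V y b \<phi>" "\<And>t. 0 \<le> t \<Longrightarrow> t < b \<Longrightarrow> \<psi> t = \<phi> t"
  shows "solution_on V y b \<psi>"
  unfolding solution_on_def
proof (intro conjI ballI)
  note \<phi> = solution_onD[OF assms(1)]
  show "0 < b" by (rule \<phi>)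
  then show "\<psi> 0 = y" using \<phi>(2) assms(2)[of 0] by simp
  fix t assume t: "t \<in> {0..<b}"
  then show "fst (\<psi> t) \<noteq> 0" using \<phi>(3) assms(2) by simp
  have "(\<phi> has_vector_derivative vector_field V (\<psi> t)) (at t within {0..<b})"
    using t \<phi>(4)[of t] assms(2)[of t] by simp
  then show "(\<psi> has_vector_derivative vector_field V (\<psi> t)) (at t within {0..<b})"
    by (rule has_vector_derivative_transform[OF t, rotated]) (use assms(2) in auto)
qed

text \<open>Compactness of the time interval; it lets a piece of an orbit be treated as an orbit of
  the clamped, globally Lipschitz field. The extremal radii are halved and doubled so that the
  bounds become strict.\<close>

lemma solution_annulus:
  assumes "solution_on V y b \<phi>" "0 \<le> c" "c < b"
  obtains \<epsilon> M where "0 < \<epsilon>" "\<epsilon> < M" "\<And>t. 0 \<le> t \<Longrightarrow> t \<le> c \<Longrightarrow> \<epsilon> < norm (fst (\<phi> t)) \<and> norm (fst (\<phi> t)) < M"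
proof -
  have cont: "continuous_on {0..c} (\<lambda>t. norm (fst (\<phi> t)))"
    using assms by (intro continuous_intros continuous_on_subset[OF solution_onD(6)[OF assms(1)]]) auto
  obtain s where s: "s \<in> {0..c}" "\<And>t. t \<in> {0..c} \<Longrightarrow> norm (fst (\<phi> s)) \<le> norm (fst (\<phi> t))"
    using continuous_attains_inf[OF _ _ cont] assms by auto
  obtain r where r: "r \<in> {0..c}" "\<And>t. t \<in> {0..c} \<Longrightarrow> norm (fst (\<phi> t)) \<le> norm (fst (\<phi> r))"
    using continuous_attains_sup[OF _ _ cont] assms by auto
  have pos: "norm (fst (\<phi> s)) > 0" using solution_onD(3)[OF assms(1), of s] s(1) assms by auto
  show ?thesis
  proof (rule that[of "norm (fst (\<phi> s)) / 2" "2 * norm (fst (\<phi> r))"])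
    show "0 < norm (fst (\<phi> s)) / 2" using pos by simp
    show "norm (fst (\<phi> s)) / 2 < 2 * norm (fst (\<phi> r))" using pos s(2)[OF r(1)] by linarith
    fix t assume "0 \<le> t" "t \<le> c"
    then show "norm (fst (\<phi> s)) / 2 < norm (fst (\<phi> t)) \<and> norm (fst (\<phi> t)) < 2 * norm (fst (\<phi> r))"
      using s(2)[of t] r(2)[of t] pos unfolding atLeastAtMost_iff by linarith
  qed
qed

lemma solution_on_reg_field:
  assumes "solution_on V y b \<phi>" "0 < \<epsilon>" "c < b"
    and "\<And>t. 0 \<le> t \<Longrightarrow> t \<le> c \<Longrightarrow> \<epsilon> \<le> norm (fst (\<phi> t)) \<and> norm (fst (\<phi> t)) \<le> M"
    and "t \<in> {0..c}"
  shows "(\<phi> has_vector_derivative reg_field \<epsilon> M (\<phi> t)) (at t within {0..c})"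
proof -
  have "(\<phi> has_vector_derivative vector_field V (\<phi> t)) (at t within {0..c})"
    using assms by (intro has_vector_derivative_within_subset[OF solution_onD(4)[OF assms(1)]]) auto
  then show ?thesis using assms by (subst reg_field_eq_vector_field) auto
qed

lemma reg_field_solution_on:
  assumes "0 < \<epsilon>" "0 < b" "\<gamma> 0 = y"
    and "\<And>t. 0 \<le> t \<Longrightarrow> (\<gamma> has_vector_derivative reg_field \<epsilon> M (\<gamma> t)) (at t within {0..})"
    and "\<And>t. 0 \<le> t \<Longrightarrow> t < b \<Longrightarrow> \<epsilon> \<le> norm (fst (\<gamma> t)) \<and> norm (fst (\<gamma> t)) \<le> M"
  shows "solution_on V y b \<gamma>"
  unfolding solution_on_def
proof (intro conjI ballI)
  fix t assume t: "t \<in> {0..<b}"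
  then show "fst (\<gamma> t) \<noteq> 0" using assms(1) assms(5)[of t] by auto
  show "(\<gamma> has_vector_derivative vector_field V (\<gamma> t)) (at t within {0..<b})"
    using has_vector_derivative_within_subset[OF assms(4)[of t], of "{0..<b}"] t assms(1) assms(5)[of t]
    by (auto simp: reg_field_eq_vector_field atLeastLessThan_def)
qed (use assms in auto)

text \<open>Up to time \<open>t\<close> both orbits lie in a common annulus, where they solve the
  same clamped equation, and Gronwall applies with initial distance 0.\<close>

lemma solution_unique:
  assumes \<phi>: "solution_on V y b \<phi>" and \<psi>: "solution_on V y b' \<psi>" and t: "0 \<le> t" "t < b" "t < b'"
  shows "\<phi> t = \<psi> t"
proof -
  obtain \<epsilon>1 M1 where 1: "0 < \<epsilon>1" "\<epsilon>1 < M1" "\<And>s. 0 \<le> s \<Longrightarrow> s \<le> t \<Longrightarrow> \<epsilon>1 < norm (fst (\<phi> s)) \<and> norm (fst (\<phi> s)) < M1"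
    using solution_annulus[OF \<phi> t(1,2)] by blast
  obtain \<epsilon>2 M2 where 2: "0 < \<epsilon>2" "\<epsilon>2 < M2" "\<And>s. 0 \<le> s \<Longrightarrow> s \<le> t \<Longrightarrow> \<epsilon>2 < norm (fst (\<psi> s)) \<and> norm (fst (\<psi> s)) < M2"
    using solution_annulus[OF \<psi> t(1,3)] by blast
  define \<epsilon> M where "\<epsilon> = min \<epsilon>1 \<epsilon>2" and "M = max M1 M2"
  have \<epsilon>: "0 < \<epsilon>" "\<epsilon> \<le> M" using 1 2 by (auto simp: \<epsilon>_def M_def)
  obtain K where K: "\<And>y z. norm (reg_field \<epsilon> M y - reg_field \<epsilon> M z) \<le> K * norm (y - z)"
    using reg_field_Lipschitz[OF \<epsilon>] by blast
  have a: "\<epsilon> \<le> norm (fst (\<phi> s)) \<and> norm (fst (\<phi> s)) \<le> M" "\<epsilon> \<le> norm (fst (\<psi> s)) \<and> norm (fst (\<psi> s)) \<le> M"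
    if "0 \<le> s" "s \<le> t" for s
    using 1(3)[OF that] 2(3)[OF that] by (auto simp: \<epsilon>_def M_def)
  have "norm (\<phi> t - \<psi> t) \<le> exp (K * t) * norm (\<phi> 0 - \<psi> 0)"
    by (rule gronwall_Lipschitz[OF K solution_on_reg_field[OF \<phi> \<epsilon>(1) t(2) a(1)] solution_on_reg_field[OF \<psi> \<epsilon>(1) t(3) a(2)]])
      (use t in auto)
  then show ?thesis using solution_onD(2)[OF \<phi>] solution_onD(2)[OF \<psi>] by simp
qed

text \<open>A solution living beyond \<open>T0\<close> would be continuous there, with the limit
  position 0 that solutions must avoid. This makes the collision time unique and keeps the two
  alternatives in \<open>flow_reaches\<close> disjoint.\<close>

lemma collision_not_continuable:
  assumes c: "collision_solution V y T0 \<phi>" and s: "solution_on V y b \<psi>"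
  shows "b \<le> T0"
proof (rule ccontr)
  assume "\<not> b \<le> T0"
  then have b: "T0 < b" by simp
  have \<phi>: "solution_on V y T0 \<phi>" and lim: "((\<lambda>t. fst (\<phi> t)) \<longlongrightarrow> 0) (at_left T0)"
    using c by (auto simp: collision_solution_def)
  have T0: "0 < T0" using solution_onD(1)[OF \<phi>] .
  have "isCont \<psi> T0"
    using solution_onD(5)[OF s T0 b] by (rule has_vector_derivative_continuous)
  then have "((\<lambda>t. fst (\<psi> t)) \<longlongrightarrow> fst (\<psi> T0)) (at_left T0)"
    by (intro tendsto_fst) (simp add: continuous_within filterlim_at_split)
  moreover have "\<forall>\<^sub>F t in at_left T0. fst (\<psi> t) = fst (\<phi> t)"
    using eventually_at_left_real[OF T0]
    by eventually_elim (use solution_unique[OF s \<phi>] b in auto)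
  ultimately have "((\<lambda>t. fst (\<phi> t)) \<longlongrightarrow> fst (\<psi> T0)) (at_left T0)"
    by (rule Lim_transform_eventually)
  then have "fst (\<psi> T0) = 0" using tendsto_unique[OF _ _ lim] by simp
  then show False using solution_onD(3)[OF s, of T0] T0 b by simp
qed

lemma flow_reaches_unique:
  assumes "flow_reaches V y t z" "flow_reaches V y t z'"
  shows "z = z'"
proof -
  have reg: "z = \<phi> t" if "solution_on V y b \<phi>" "0 \<le> t" "t < b" "flow_reaches V y t z" for z b \<phi>
    using that(4) unfolding flow_reaches_def
  proof (elim disjE exE conjE)
    fix b' \<psi> assume "solution_on V y b' \<psi>" "0 \<le> t" "t < b'" "z = \<psi> t"
    then show ?thesis using solution_unique[OF that(1), of b' \<psi> t] that by simp
  next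
    fix T0 \<psi> assume "collision_solution V y T0 \<psi>" "T0 < t"
    then show ?thesis using collision_not_continuable[OF _ that(1)] that by fastforce
  qed
  have col: "z = transmission T0 \<phi> t"
    if "collision_solution V y T0 \<phi>" "T0 < t" "t < 2 * T0" "flow_reaches V y t z" for z T0 \<phi>
    using that(4) unfolding flow_reaches_def
  proof (elim disjE exE conjE)
    fix b' \<psi> assume "solution_on V y b' \<psi>" "0 \<le> t" "t < b'" "z = \<psi> t"
    then show ?thesis using collision_not_continuable[OF that(1)] that by fastforce
  next
    fix T1 \<psi> assume T1: "collision_solution V y T1 \<psi>" "T1 < t" "t < 2 * T1" "z = transmission T1 \<psi> t"
    have s: "solution_on V y T0 \<phi>" "solution_on V y T1 \<psi>" using that T1 by (auto simp: collision_solution_def)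
    have "T1 = T0"
      using collision_not_continuable[OF that(1) s(2)] collision_not_continuable[OF T1(1) s(1)] by simp
    then show ?thesis
      using T1 that solution_unique[OF s, of "2 * T0 - t"] by (simp add: transmission_def)
  qed
  show ?thesis
    using assms(1)[unfolded flow_reaches_def]
  proof (elim disjE exE conjE)
    fix b \<phi> assume "solution_on V y b \<phi>" "0 \<le> t" "t < b" "z = \<phi> t"
    then show ?thesis using reg[OF _ _ _ assms(2)] by simp
  next
    fix T0 \<phi> assume "collision_solution V y T0 \<phi>" "T0 < t" "t < 2 * T0" "z = transmission T0 \<phi> t"
    then show ?thesis using col[OF _ _ _ assms(2)] by simp
  qed
qed

lemma flow_domain_iff: "(y, t) \<in> flow_domain V \<longleftrightarrow> (\<exists>z. flow_reaches V y t z)"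
proof -
  have "(y, t) \<in> flow_domain V \<longleftrightarrow> (\<exists>!z. flow_reaches V y t z)"
    by (simp only: flow_domain_def mem_Collect_eq prod.case)
  then show ?thesis by (blast intro: flow_reaches_unique)
qed

lemma Phi_eqI: "flow_reaches V y t z \<Longrightarrow> Phi V y t = z"
  unfolding Phi_def using flow_reaches_unique by blast

lemma Phi_solution:
  assumes "solution_on V y b \<phi>" "0 \<le> t" "t < b"
  shows "flow_reaches V y t (\<phi> t)" "Phi V y t = \<phi> t"
proof -
  show "flow_reaches V y t (\<phi> t)" using assms unfolding flow_reaches_def by blast
  then show "Phi V y t = \<phi> t" by (rule Phi_eqI)
qed

lemma Phi_collision:
  assumes "collision_solution V y T0 \<phi>" "T0 < t" "t < 2 * T0"
  shows "flow_reaches V y t (transmission T0 \<phi> t)" "Phi V y t = transmission T0 \<phi> t"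
proof -
  show "flow_reaches V y t (transmission T0 \<phi> t)" using assms unfolding flow_reaches_def by blast
  then show "Phi V y t = transmission T0 \<phi> t" by (rule Phi_eqI)
qed

text \<open>Replaces an arbitrary witness by the canonical orbit, so that later statements about
  many data need no choice of a solution for each of them.\<close>

lemma solution_on_Phi:
  assumes "solution_on V y b \<phi>"
  shows "solution_on V y b (Phi V y)"
  by (rule solution_on_cong[OF assms Phi_solution(2)[OF assms]])

lemma collision_solution_Phi:
  assumes "collision_solution V y T0 \<phi>"
  shows "collision_solution V y T0 (Phi V y)"
proof -
  have s: "solution_on V y T0 \<phi>" and lim: "((\<lambda>t. fst (\<phi> t)) \<longlongrightarrow> 0) (at_left T0)"
    using assms by (auto simp: collision_solution_def)
  have "\<forall>\<^sub>F t in at_left T0. fst (\<phi> t) = fst (Phi V y t)"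
    using eventually_at_left_real[OF solution_onD(1)[OF s]]
    by eventually_elim (simp add: Phi_solution(2)[OF s])
  with lim have "((\<lambda>t. fst (Phi V y t)) \<longlongrightarrow> 0) (at_left T0)" by (rule Lim_transform_eventually)
  then show ?thesis using solution_on_Phi[OF s] by (simp add: collision_solution_def)
qed

text \<open>The clamped system has a global solution from every \<open>z\<close>. By Gronwall it
  follows the given orbit closely enough up to time \<open>c\<close> to stay in a slightly larger
  annulus, where clamping has no effect, so it is a genuine solution.\<close>

lemma solution_nearby:
  assumes "solution_on V y b \<phi>" "0 < c" "c < b" "0 < e"
  obtains \<delta> where "0 < \<delta>" "\<And>z. z \<in> ball y \<delta> \<Longrightarrow> solution_on V z c (Phi V z)"
    "\<And>z s. z \<in> ball y \<delta> \<Longrightarrow> 0 \<le> s \<Longrightarrow> s < c \<Longrightarrow> dist (Phi V z s) (Phi V y s) < e"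
proof -
  obtain \<epsilon> M where *: "0 < \<epsilon>" "\<epsilon> < M" "\<And>t. 0 \<le> t \<Longrightarrow> t \<le> c \<Longrightarrow> \<epsilon> < norm (fst (\<phi> t)) \<and> norm (fst (\<phi> t)) < M"
    using solution_annulus[OF assms(1), of c] assms by auto
  define \<epsilon>' M' where "\<epsilon>' = \<epsilon> / 2" and "M' = M + \<epsilon>"
  have \<epsilon>: "0 < \<epsilon>'" "\<epsilon>' \<le> M'" using * by (auto simp: \<epsilon>'_def M'_def)
  obtain K where K: "K > 0" "\<And>y z. norm (reg_field \<epsilon>' M' y - reg_field \<epsilon>' M' z) \<le> K * norm (y - z)"
    using reg_field_Lipschitz[OF \<epsilon>] by blast
  \<comment> \<open>The exponential cancels the Gronwall factor at the final time
    \<open>c\<close>.\<close>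
  define \<delta> where "\<delta> = min \<epsilon>' e * exp (- K * c)"
  have d\<phi>: "(\<phi> has_vector_derivative reg_field \<epsilon>' M' (\<phi> t)) (at t within {0..c})" if "t \<in> {0..c}" for t
    by (rule solution_on_reg_field[OF assms(1) \<epsilon>(1) assms(3) _ that]) (use *(1) *(3) in \<open>force simp: \<epsilon>'_def M'_def\<close>)
  have main: "solution_on V z c (Phi V z) \<and> (\<forall>s. 0 \<le> s \<and> s < c \<longrightarrow> dist (Phi V z s) (Phi V y s) < e)"
    if z: "z \<in> ball y \<delta>" for z
  proof -
    obtain \<gamma> where \<gamma>: "\<gamma> 0 = z" "\<And>t. 0 \<le> t \<Longrightarrow> (\<gamma> has_vector_derivative reg_field \<epsilon>' M' (\<gamma> t)) (at t within {0..})"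
      using global_solution_exists[OF K] by blast
    have close: "norm (\<gamma> t - \<phi> t) < min \<epsilon>' e" if t: "0 \<le> t" "t \<le> c" for t
    proof -
      have "norm (\<gamma> t - \<phi> t) \<le> exp (K * t) * norm (\<gamma> 0 - \<phi> 0)"
        by (rule gronwall_Lipschitz[OF K(2) has_vector_derivative_within_subset[OF \<gamma>(2)] d\<phi>]) (use t in auto)
      also have "\<dots> \<le> exp (K * c) * norm (z - y)"
        using t K(1) by (simp add: \<gamma>(1) solution_onD(2)[OF assms(1)] mult_right_mono)
      also have "\<dots> < exp (K * c) * \<delta>"
        using z by (simp add: dist_norm norm_minus_commute)
      also have "\<dots> = min \<epsilon>' e" by (simp add: \<delta>_def exp_minus)
      finally show ?thesis .
    qed
    have ann: "\<epsilon>' \<le> norm (fst (\<gamma> t)) \<and> norm (fst (\<gamma> t)) \<le> M'" if t: "0 \<le> t" "t \<le> c" for t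
    proof -
      have "norm (fst (\<gamma> t) - fst (\<phi> t)) < \<epsilon>'"
        using close[OF t] norm_fst_diff_le[of "\<gamma> t" "\<phi> t"] by simp
      then show ?thesis
        using *(3)[OF t] norm_triangle_ineq3[of "fst (\<gamma> t)" "fst (\<phi> t)"] by (auto simp: \<epsilon>'_def M'_def)
    qed
    have s: "solution_on V z c \<gamma>"
      by (rule reg_field_solution_on[OF \<epsilon>(1) assms(2) \<gamma>]) (use ann in auto)
    have "dist (Phi V z s) (Phi V y s) < e" if "0 \<le> s" "s < c" for s
      using close[of s] that Phi_solution(2)[OF s that] Phi_solution(2)[OF assms(1), of s] assms
      by (simp add: dist_norm)
    then show ?thesis using solution_on_Phi[OF s] by blast
  qed
  show ?thesis
    by (rule that[of \<delta>]) (use main \<epsilon> assms in \<open>auto simp: \<delta>_def\<close>)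
qed

text \<open>Bounds on the radius alone suffice: the clamped system, globally Lipschitz in the
  velocity too, has a solution for all times. It agrees with \<open>\<phi>\<close> before
  \<open>b\<close> and, by continuity of the radius, remains in a larger annulus a little
  beyond.\<close>

lemma solution_extend:
  assumes "solution_on V y b \<phi>" "0 < \<epsilon>"
    and ann: "\<And>t. 0 \<le> t \<Longrightarrow> t < b \<Longrightarrow> \<epsilon> \<le> norm (fst (\<phi> t)) \<and> norm (fst (\<phi> t)) \<le> M"
  obtains b' where "b < b'" "solution_on V y b' (Phi V y)"
proof -
  have b: "0 < b" using solution_onD(1)[OF assms(1)] .
  define \<epsilon>' M' where "\<epsilon>' = \<epsilon> / 2" and "M' = M + \<epsilon>"
  have M: "\<epsilon> \<le> M" using ann[of 0] b by simp
  have \<epsilon>: "0 < \<epsilon>'" "\<epsilon>' \<le> M'" using M assms by (auto simp: \<epsilon>'_def M'_def)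
  obtain K where K: "K > 0" "\<And>y z. norm (reg_field \<epsilon>' M' y - reg_field \<epsilon>' M' z) \<le> K * norm (y - z)"
    using reg_field_Lipschitz[OF \<epsilon>] by blast
  obtain \<gamma> where \<gamma>: "\<gamma> 0 = y" "\<And>t. 0 \<le> t \<Longrightarrow> (\<gamma> has_vector_derivative reg_field \<epsilon>' M' (\<gamma> t)) (at t within {0..})"
    using global_solution_exists[OF K] by blast
  have eq: "\<gamma> t = \<phi> t" if t: "0 \<le> t" "t < b" for t
  proof -
    have "norm (\<gamma> t - \<phi> t) \<le> exp (K * t) * norm (\<gamma> 0 - \<phi> 0)"
      by (rule gronwall_Lipschitz[OF K(2) has_vector_derivative_within_subset[OF \<gamma>(2)]
            solution_on_reg_field[OF assms(1) \<epsilon>(1) t(2)]]) (use t ann assms(2) in \<open>force simp: \<epsilon>'_def M'_def\<close>)+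
    then show ?thesis using \<gamma>(1) solution_onD(2)[OF assms(1)] by simp
  qed
  have cont: "continuous_on {0..} (\<lambda>t. norm (fst (\<gamma> t)))"
    using has_vector_derivative_continuous[OF \<gamma>(2)]
    by (intro continuous_intros) (auto simp: continuous_on_eq_continuous_within)
  have "isCont (\<lambda>t. norm (fst (\<gamma> t))) b"
    using continuous_on_interior[OF cont, of b] b by simp
  then have lim: "((\<lambda>t. norm (fst (\<gamma> t))) \<longlongrightarrow> norm (fst (\<gamma> b))) (at b)" by (simp add: isCont_def)
  then have limL: "((\<lambda>t. norm (fst (\<gamma> t))) \<longlongrightarrow> norm (fst (\<gamma> b))) (at_left b)"
    by (simp add: filterlim_at_split)
  have ev: "\<forall>\<^sub>F t in at_left b. \<epsilon> \<le> norm (fst (\<gamma> t)) \<and> norm (fst (\<gamma> t)) \<le> M"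
    using eventually_at_left_real[OF b] by eventually_elim (use ann eq in auto)
  have bb: "\<epsilon> \<le> norm (fst (\<gamma> b))" "norm (fst (\<gamma> b)) \<le> M"
    by (rule tendsto_lowerbound[OF limL eventually_mono[OF ev]], simp_all)
      (rule tendsto_upperbound[OF limL eventually_mono[OF ev]], simp_all)
  have "\<forall>\<^sub>F t in at b. \<epsilon>' < norm (fst (\<gamma> t)) \<and> norm (fst (\<gamma> t)) < M'"
    using bb assms(2)
    by (intro eventually_conj order_tendstoD(1)[OF lim] order_tendstoD(2)[OF lim]) (auto simp: \<epsilon>'_def M'_def)
  then obtain d where d: "d > 0" "\<And>t. t \<noteq> b \<Longrightarrow> dist t b < d \<Longrightarrow> \<epsilon>' < norm (fst (\<gamma> t)) \<and> norm (fst (\<gamma> t)) < M'"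
    by (auto simp: eventually_at)
  have "solution_on V y (b + d) \<gamma>"
  proof (rule reg_field_solution_on[OF \<epsilon>(1) _ \<gamma>])
    show "0 < b + d" using b d by simp
    fix t assume t: "0 \<le> t" "t < b + d"
    consider "t < b" | "t = b" | "b < t" by linarith
    then show "\<epsilon>' \<le> norm (fst (\<gamma> t)) \<and> norm (fst (\<gamma> t)) \<le> M'"
    proof cases
      case 1 then show ?thesis using ann[of t] eq[of t] t assms(2) by (auto simp: \<epsilon>'_def M'_def)
    next
      case 2 then show ?thesis using bb assms(2) by (auto simp: \<epsilon>'_def M'_def)
    next
      case 3 then show ?thesis using d(2)[of t] t by (force simp: dist_real_def)
    qed
  qed
  then show ?thesis using that[of "b + d"] solution_on_Phi d(1) by auto
qed

text \<open>The cap \<open>B\<close> keeps the supremum of the existence times finite. The last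
  conclusion is the escape alternative: an orbit that ends before the cap leaves every
  annulus.\<close>

lemma maximal_solution:
  assumes "solution_on V y b0 \<phi>" "b0 < B"
  obtains b where "b0 \<le> b" "b \<le> B" "solution_on V y b (Phi V y)"
    "\<And>\<epsilon> M. b < B \<Longrightarrow> 0 < \<epsilon> \<Longrightarrow> \<exists>t. 0 \<le> t \<and> t < b \<and> \<not> (\<epsilon> \<le> norm (fst (Phi V y t)) \<and> norm (fst (Phi V y t)) \<le> M)"
proof -
  define A where "A = {b. b \<le> B \<and> solution_on V y b (Phi V y)}"
  have b0: "b0 \<in> A" using assms solution_on_Phi by (auto simp: A_def)
  have bdd: "bdd_above A" by (auto simp: A_def bdd_above_def)
  define b where "b = Sup A"
  have up: "c \<le> b" if "c \<in> A" for c unfolding b_def by (rule cSup_upper[OF that bdd])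
  have bB: "b \<le> B" unfolding b_def by (rule cSup_least) (use b0 in \<open>auto simp: A_def\<close>)
  have pos: "0 < b" using up[OF b0] solution_onD(1)[OF assms(1)] by simp
  have ex: "\<exists>c\<in>A. t < c" if "t < b" for t
    using that less_cSup_iff[of A t] b0 bdd by (auto simp: b_def)
  have sol: "solution_on V y b (Phi V y)"
    unfolding solution_on_def
  proof (intro conjI ballI)
    show "Phi V y 0 = y" using b0 by (auto simp: A_def dest: solution_onD(2))
    fix t assume "t \<in> {0..<b}"
    then have t: "0 \<le> t" "t < b" by auto
    then obtain c where c: "c \<in> A" "t < c" using ex by blast
    then have s: "solution_on V y c (Phi V y)" by (simp add: A_def)
    show "fst (Phi V y t) \<noteq> 0" using solution_onD(3)[OF s] t c by simp
    have "at t within {0..<c} = at t within {0..<b}"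
      by (rule at_within_nhd[of _ "{..<c}"]) (use c up in force)+
    then show "(Phi V y has_vector_derivative vector_field V (Phi V y t)) (at t within {0..<b})"
      using solution_onD(4)[OF s, of t] t c by simp
  qed (rule pos)
  show ?thesis
  proof (rule that[of b, OF up[OF b0] bB sol])
    fix \<epsilon> M :: real assume "b < B" "0 < \<epsilon>"
    show "\<exists>t. 0 \<le> t \<and> t < b \<and> \<not> (\<epsilon> \<le> norm (fst (Phi V y t)) \<and> norm (fst (Phi V y t)) \<le> M)"
    proof (rule ccontr)
      assume "\<not> ?thesis"
      then have "\<And>t. 0 \<le> t \<Longrightarrow> t < b \<Longrightarrow> \<epsilon> \<le> norm (fst (Phi V y t)) \<and> norm (fst (Phi V y t)) \<le> M" by blast
      from solution_extend[OF sol \<open>0 < \<epsilon>\<close> this] obtain b' where b': "b < b'" "solution_on V y b' (Phi V y)" by blast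
      have "min b' B \<in> A" using b' \<open>b < B\<close> pos solution_on_subset[OF b'(2), of "min b' B"] by (auto simp: A_def)
      then show False using up[of "min b' B"] b' \<open>b < B\<close> by auto
    qed
  qed
qed

end

section \<open>The potential near the singularity\<close>

locale star_potential =
  fixes V :: "real \<Rightarrow> real"
  assumes V_star: "V \<in> V_star_class"

sublocale star_potential \<subseteq> smooth_potential
  using V_star by unfold_locales (simp add: V_star_class_def V_class_def)

context star_potential
begin

lemma V_at_top: "filterlim V at_top (at_right 0)"
  using V_star by (simp add: V_star_class_def V_class_def)

lemma V_slowly_varying: "0 < \<eta> \<Longrightarrow> \<forall>\<^sub>F l in at_right 0. \<bar>V (2 * l) / V l - 1\<bar> < \<eta>"
proof -
  assume \<eta>: "0 < \<eta>"
  have "uniform_limit {1..2} (\<lambda>l x. V (l * x) / V l) (\<lambda>x. 1) (at_right 0)"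
    using V_star by (simp add: V_star_class_def)
  from uniform_limitD[OF this \<eta>] show ?thesis
    by eventually_elim (auto simp: dist_real_def mult.commute dest: bspec[of _ _ 2])
qed

text \<open>Since \<open>V'\<close> increases, the mean slope on \<open>[r/2, r]\<close> is at most
  \<open>V'(r)\<close>. This turns control of an increment of \<open>V\<close>, which slow variation
  provides, into control of the derivative.\<close>

lemma V_below_tangent:
  obtains s where "0 < s" "\<And>r. 0 < r \<Longrightarrow> r < s \<Longrightarrow> deriv V r < 0"
    "\<And>r. 0 < r \<Longrightarrow> r < s \<Longrightarrow> - (r * deriv V r) \<le> 2 * (V (r / 2) - V r)"
proof -
  obtain S where S: "convex_decreasing_up_to V S"
    using V_star by (auto simp: V_star_class_def V_class_def)
  obtain s where s: "0 < s" "ereal s < S"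
  proof (cases S)
    case (real u)
    then show ?thesis using that[of "u / 2"] S by (auto simp: convex_decreasing_up_to_def)
  qed (use that[of 1] S in \<open>auto simp: convex_decreasing_up_to_def\<close>)
  have d: "deriv V r < 0" "deriv (deriv V) r > 0" if "0 < r" "r < s" for r
  proof -
    have "ereal r < S" using that s by (meson ereal_less_eq(3) less_imp_le order_le_less_trans)
    then show "deriv V r < 0" "deriv (deriv V) r > 0"
      using S that by (auto simp: convex_decreasing_up_to_def)
  qed
  show ?thesis
  proof (rule that[OF s(1) d(1)])
    fix r assume r: "0 < r" "r < s"
    have "\<exists>z>r/2. z < r \<and> V r - V (r / 2) = (r - r / 2) * deriv V z"
      by (rule MVT2) (use r in \<open>auto intro!: V_has_deriv\<close>)
    then obtain z where z: "r / 2 < z" "z < r" "V r - V (r / 2) = (r / 2) * deriv V z" by auto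
    have "deriv V z \<le> deriv V r"
      by (rule DERIV_nonneg_imp_nondecreasing)
        (use z r d(2) in \<open>auto intro!: exI conjI V'_has_deriv less_imp_le\<close>)
    then have "(r / 2) * deriv V z \<le> (r / 2) * deriv V r" using r by (intro mult_left_mono) auto
    then show "- (r * deriv V r) \<le> 2 * (V (r / 2) - V r)" using z(3) by simp
  qed
qed

lemma V_elasticity_small:
  assumes "0 < \<eta>"
  obtains r0 where "0 < r0" "\<And>r. 0 < r \<Longrightarrow> r < r0 \<Longrightarrow> \<bar>r * deriv V r\<bar> \<le> \<eta> * V r"
    "\<And>r. 0 < r \<Longrightarrow> r < r0 \<Longrightarrow> B \<le> V r"
proof -
  \<comment> \<open>The bound 1/2 yields \<open>V (r / 2) \<le> 2 * V r\<close>; this factor 2 and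
    the factor 2 of the tangent estimate account for the 4.\<close>
  define e where "e = min (1/2) (\<eta> / 4)"
  have e: "0 < e" "e \<le> 1/2" "4 * e \<le> \<eta>" using assms by (auto simp: e_def)
  obtain s where s: "0 < s" "\<And>r. 0 < r \<Longrightarrow> r < s \<Longrightarrow> deriv V r < 0"
    "\<And>r. 0 < r \<Longrightarrow> r < s \<Longrightarrow> - (r * deriv V r) \<le> 2 * (V (r / 2) - V r)"
    by (rule V_below_tangent) blast
  have "\<forall>\<^sub>F l in at_right 0. \<bar>V (2 * l) / V l - 1\<bar> < e \<and> max 1 B \<le> V l"
    using V_slowly_varying[OF e(1)] filterlim_at_top[THEN iffD1, OF V_at_top, rule_format, of "max 1 B"]
    by (rule eventually_conj)
  then obtain u where u: "u > 0" "\<And>l. 0 < l \<Longrightarrow> l < u \<Longrightarrow> \<bar>V (2 * l) / V l - 1\<bar> < e \<and> max 1 B \<le> V l"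
    by (auto simp: eventually_at_right_field)
  show ?thesis
  proof (rule that[of "min s u"])
    show "0 < min s u" using s u by simp
    fix r assume r: "0 < r" "r < min s u"
    show "B \<le> V r" using u(2)[of r] r by simp
    have V: "V (r / 2) \<ge> 1" "V r \<ge> 1" using u(2)[of "r / 2"] u(2)[of r] r by auto
    have "\<bar>V r / V (r / 2) - 1\<bar> < e" using u(2)[of "r / 2"] r by simp
    then have "1 - V r / V (r / 2) \<le> e" by linarith
    then have 1: "V (r / 2) - V r \<le> e * V (r / 2)" using V by (simp add: field_simps)
    also have "\<dots> \<le> 1/2 * V (r / 2)" using e V by (intro mult_right_mono) auto
    finally have "V (r / 2) \<le> 2 * V r" by simp
    then have "e * V (r / 2) \<le> e * (2 * V r)" using e by (intro mult_left_mono) auto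
    then have "- (r * deriv V r) \<le> 4 * e * V r" using s(3)[of r] r 1 by auto
    also have "\<dots> \<le> \<eta> * V r" using e V by (intro mult_right_mono) auto
    finally have "- (r * deriv V r) \<le> \<eta> * V r" .
    moreover have "r * deriv V r \<le> 0" using s(2)[of r] r by (simp add: mult_le_0_iff)
    ultimately show "\<bar>r * deriv V r\<bar> \<le> \<eta> * V r" by linarith
  qed
qed

text \<open>With elasticity at most 1, the derivative \<open>V + r * V'\<close> of
  \<open>r * V\<close> is nonnegative near 0, so \<open>r * V\<close> is bounded by its value at a
  fixed radius.\<close>

lemma r_V_bounded:
  obtains r1 C where "0 < r1" "0 < C" "\<And>r. 0 < r \<Longrightarrow> r < r1 \<Longrightarrow> r * V r \<le> C"
proof -
  obtain r0 where r0: "0 < r0" "\<And>r. 0 < r \<Longrightarrow> r < r0 \<Longrightarrow> \<bar>r * deriv V r\<bar> \<le> 1 * V r"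
    "\<And>r. 0 < r \<Longrightarrow> r < r0 \<Longrightarrow> 1 \<le> V r"
    by (rule V_elasticity_small[of 1 1]) auto
  show ?thesis
  proof (rule that[of "r0 / 2" "r0 / 2 * V (r0 / 2)"])
    show "0 < r0 / 2" "0 < r0 / 2 * V (r0 / 2)" using r0(1) r0(3)[of "r0 / 2"] by auto
    fix r assume r: "0 < r" "r < r0 / 2"
    show "r * V r \<le> r0 / 2 * V (r0 / 2)"
    proof (rule DERIV_nonneg_imp_nondecreasing[where f = "\<lambda>r. r * V r"])
      show "r \<le> r0 / 2" using r by simp
      fix s assume s: "r \<le> s" "s \<le> r0 / 2"
      have "((\<lambda>r. r * V r) has_real_derivative V s + s * deriv V s) (at s)"
        using V_has_deriv[of s] s r by (auto intro!: derivative_eq_intros)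
      then show "\<exists>y. ((\<lambda>r. r * V r) has_real_derivative y) (at s) \<and> 0 \<le> y"
        using r0(2)[of s] s r by auto
    qed
  qed
qed

text \<open>By conservation of energy, \<open>2 * (E + V r)\<close> is the squared speed.\<close>

lemma near_singularity:
  assumes "0 < \<eta>"
  obtains r0 where "0 < r0"
    "\<And>r E. 0 < r \<Longrightarrow> r < r0 \<Longrightarrow> E0 \<le> E \<Longrightarrow> \<bar>r * deriv V r\<bar> \<le> \<eta> * (2 * (E + V r))"
    "\<And>r E. 0 < r \<Longrightarrow> r < r0 \<Longrightarrow> E0 \<le> E \<Longrightarrow> 1 \<le> 2 * (E + V r)"
proof -
  obtain r0 where r0: "0 < r0" "\<And>r. 0 < r \<Longrightarrow> r < r0 \<Longrightarrow> \<bar>r * deriv V r\<bar> \<le> \<eta> * V r"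
    "\<And>r. 0 < r \<Longrightarrow> r < r0 \<Longrightarrow> max 1 (- 2 * E0) \<le> V r"
    using V_elasticity_small[OF assms] by blast
  have *: "V r \<le> 2 * (E + V r)" "1 \<le> V r" if "0 < r" "r < r0" "E0 \<le> E" for r E
    using r0(3)[OF that(1,2)] that by auto
  show ?thesis
  proof (rule that[OF r0(1)])
    fix r E assume r: "0 < r" "r < r0" "E0 \<le> E"
    show "1 \<le> 2 * (E + V r)" using *[OF r] by simp
    have "\<eta> * V r \<le> \<eta> * (2 * (E + V r))" using *[OF r] assms by (intro mult_left_mono) auto
    then show "\<bar>r * deriv V r\<bar> \<le> \<eta> * (2 * (E + V r))" using r0(2)[OF r(1,2)] by linarith
  qed
qed

text \<open>The quantity is r^2 |v|^2 on an orbit of energy \<open>E\<close>. It dominates both the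
  squared angular momentum and the square of \<open>x \<bullet> v\<close>, and it vanishes with
  \<open>r\<close> because \<open>r * V\<close> is bounded.\<close>

lemma r2_kinetic_tendsto_0:
  assumes "0 < e"
  obtains r0 where "0 < r0" "\<And>r. 0 < r \<Longrightarrow> r < r0 \<Longrightarrow> r\<^sup>2 * (2 * (E + V r)) < e"
proof -
  obtain r1 C where C: "0 < r1" "0 < C" "\<And>r. 0 < r \<Longrightarrow> r < r1 \<Longrightarrow> r * V r \<le> C"
    by (rule r_V_bounded) blast
  define r0 where "r0 = Min {1, r1, e / (2 * (\<bar>E\<bar> + C))}"
  have pos: "0 < \<bar>E\<bar> + C" using C by simp
  show ?thesis
  proof (rule that[of r0])
    show "0 < r0" using C assms pos by (simp add: r0_def)
    fix r assume "0 < r" "r < r0"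
    then have r: "0 < r" "r < 1" "r < r1" "r < e / (2 * (\<bar>E\<bar> + C))" by (auto simp: r0_def)
    have "r * E \<le> r * \<bar>E\<bar>" using r by (intro mult_left_mono) auto
    moreover have "r * \<bar>E\<bar> \<le> 1 * \<bar>E\<bar>" using r by (intro mult_right_mono) auto
    ultimately have rE: "r * E \<le> \<bar>E\<bar>" by linarith
    have "r\<^sup>2 * (2 * (E + V r)) = 2 * r * (r * E + r * V r)" by (simp add: power2_eq_square algebra_simps)
    also have "2 * r * (r * E + r * V r) \<le> 2 * r * (\<bar>E\<bar> + C)"
      using C(3)[of r] rE r by (intro mult_left_mono add_mono) auto
    also have "\<dots> < e" using r(4) pos by (simp add: field_simps)
    finally show "r\<^sup>2 * (2 * (E + V r)) < e" .
  qed
qed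

end

section \<open>Conserved quantities and the turning of the velocity\<close>

lemma DERIV_inner:
  fixes f g :: "real \<Rightarrow> 'a::real_inner"
  assumes "(f has_vector_derivative f') (at t within A)" "(g has_vector_derivative g') (at t within A)"
  shows "((\<lambda>t. f t \<bullet> g t) has_real_derivative f t \<bullet> g' + f' \<bullet> g t) (at t within A)"
  using bounded_bilinear.has_vector_derivative[OF bounded_bilinear_inner assms]
  by (simp add: has_real_derivative_iff_has_vector_derivative)

lemma DERIV_norm:
  fixes f :: "real \<Rightarrow> 'a::real_inner"
  assumes f: "(f has_vector_derivative f') (at t within A)" and "f t \<noteq> 0"
  shows "((\<lambda>t. norm (f t)) has_real_derivative f t \<bullet> f' / norm (f t)) (at t within A)"
proof -
  have "0 < f t \<bullet> f t" using assms(2) by simp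
  from DERIV_chain2[where g = "\<lambda>t. f t \<bullet> f t" and x = t, OF DERIV_real_sqrt[OF this] DERIV_inner[OF f f]]
  show ?thesis unfolding norm_eq_sqrt_inner
    by (rule DERIV_cong) (simp add: inner_commute field_simps)
qed

text \<open>The force is the gradient of \<open>V\<close>, not its negative, so \<open>V\<close>
  enters with a minus sign and a singularity where \<open>V\<close> tends to infinity is
  attracting.\<close>

definition energy :: "(real \<Rightarrow> real) \<Rightarrow> phase \<Rightarrow> real" where
  "energy V y = (snd y \<bullet> snd y) / 2 - V (norm (fst y))"

text \<open>By Lagrange's identity this is the square of the angular momentum.\<close>

definition ang_mom2 :: "phase \<Rightarrow> real" where
  "ang_mom2 y = (fst y \<bullet> fst y) * (snd y \<bullet> snd y) - (fst y \<bullet> snd y)\<^sup>2"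

lemma ang_mom2_nonneg: "0 \<le> ang_mom2 y"
  using Cauchy_Schwarz_ineq[of "fst y" "snd y"] by (simp add: ang_mom2_def)

lemma ang_mom2_le: "ang_mom2 y \<le> (norm (fst y))\<^sup>2 * (2 * (energy V y + V (norm (fst y))))"
  by (simp add: ang_mom2_def energy_def power2_norm_eq_inner)

context smooth_potential
begin

text \<open>\<open>radial_deriv\<close> is the virial identity, i.e. half the second derivative of
  |x|^2. It uses that the scalar product of the position with the force is
  \<open>r * V'(r)\<close>.\<close>

lemma solution_deriv:
  assumes "solution_on V y b \<phi>" "0 \<le> t" "t < b"
  defines "x \<equiv> fst (\<phi> t)" and "v \<equiv> snd (\<phi> t)" and "F \<equiv> at t within {0..<b}"
  shows position_deriv: "((\<lambda>t. fst (\<phi> t)) has_vector_derivative v) F"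
    and velocity_deriv: "((\<lambda>t. snd (\<phi> t)) has_vector_derivative (deriv V (norm x) / norm x) *\<^sub>R x) F"
    and radius_deriv: "((\<lambda>t. norm (fst (\<phi> t))) has_real_derivative x \<bullet> v / norm x) F"
    and radial_deriv: "((\<lambda>t. fst (\<phi> t) \<bullet> snd (\<phi> t)) has_real_derivative v \<bullet> v + norm x * deriv V (norm x)) F"
    and kinetic_deriv: "((\<lambda>t. snd (\<phi> t) \<bullet> snd (\<phi> t)) has_real_derivative
      2 * (deriv V (norm x) / norm x) * (x \<bullet> v)) F"
proof -
  have x0: "x \<noteq> 0" unfolding x_def by (rule solution_onD(3)[OF assms(1-3)])
  have \<phi>: "(\<phi> has_vector_derivative (v, (deriv V (norm x) / norm x) *\<^sub>R x)) F"
    using solution_onD(4)[OF assms(1-3)] vector_field_eq[OF smooth x0[unfolded x_def]]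
    by (simp add: x_def v_def F_def)
  show 1: "((\<lambda>t. fst (\<phi> t)) has_vector_derivative v) F"
    using bounded_linear.has_vector_derivative[OF bounded_linear_fst \<phi>[unfolded F_def]] by (simp add: F_def)
  show 2: "((\<lambda>t. snd (\<phi> t)) has_vector_derivative (deriv V (norm x) / norm x) *\<^sub>R x) F"
    using bounded_linear.has_vector_derivative[OF bounded_linear_snd \<phi>[unfolded F_def]] by (simp add: F_def)
  show "((\<lambda>t. norm (fst (\<phi> t))) has_real_derivative x \<bullet> v / norm x) F"
    using DERIV_norm[OF 1[unfolded F_def]] x0 by (simp add: x_def F_def)
  show "((\<lambda>t. fst (\<phi> t) \<bullet> snd (\<phi> t)) has_real_derivative v \<bullet> v + norm x * deriv V (norm x)) F"
    using DERIV_inner[OF 1[unfolded F_def] 2[unfolded F_def]] x0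
    by (simp add: x_def v_def F_def dot_square_norm power2_eq_square algebra_simps)
  show "((\<lambda>t. snd (\<phi> t) \<bullet> snd (\<phi> t)) has_real_derivative
      2 * (deriv V (norm x) / norm x) * (x \<bullet> v)) F"
    using DERIV_inner[OF 2[unfolded F_def] 2[unfolded F_def]]
    by (simp add: x_def v_def F_def inner_commute mult.assoc)
qed

lemma energy_conserved:
  assumes "solution_on V y b \<phi>" "0 \<le> t" "t < b"
  shows "energy V (\<phi> t) = energy V y"
proof -
  have "((\<lambda>t. energy V (\<phi> t)) has_real_derivative 0) (at s within {0..<b})" if s: "s \<in> {0..<b}" for s
  proof -
    have s: "0 \<le> s" "s < b" using s by auto
    note d = solution_deriv[OF assms(1) s]
    have pos: "norm (fst (\<phi> s)) > 0" using solution_onD(3)[OF assms(1) s] by simp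
    show ?thesis unfolding energy_def
      by (rule DERIV_cong[OF DERIV_diff[OF DERIV_cdivide[OF d(5)] DERIV_chain2[OF V_has_deriv[OF pos] d(3)]]]) simp
  qed
  from has_field_derivative_zero_constant[OF _ this]
  obtain c where c: "\<And>s. s \<in> {0..<b} \<Longrightarrow> energy V (\<phi> s) = c" by auto
  show ?thesis using c[of t] c[of 0] assms(2,3) solution_onD(1,2)[OF assms(1)] by simp
qed

lemma ang_mom2_conserved:
  assumes "solution_on V y b \<phi>" "0 \<le> t" "t < b"
  shows "ang_mom2 (\<phi> t) = ang_mom2 y"
proof -
  have "((\<lambda>t. ang_mom2 (\<phi> t)) has_real_derivative 0) (at s within {0..<b})" if s: "s \<in> {0..<b}" for s
  proof -
    have s: "0 \<le> s" "s < b" using s by auto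
    note d = solution_deriv[OF assms(1) s]
    have pos: "norm (fst (\<phi> s)) > 0" using solution_onD(3)[OF assms(1) s] by simp
    have alg: "X * (2 * (h / r) * q) + (q + q') * n - real 2 * ((n + r * h) * q ^ (2 - Suc 0)) = 0"
      if "X = r\<^sup>2" "q' = q" "r > 0" for X h r q q' n :: real
      using that by (simp add: power2_eq_square field_simps)
    have "((\<lambda>t. (fst (\<phi> t) \<bullet> fst (\<phi> t)) * (snd (\<phi> t) \<bullet> snd (\<phi> t)))
        has_real_derivative (fst (\<phi> s) \<bullet> fst (\<phi> s)) *
        (2 * (deriv V (norm (fst (\<phi> s))) / norm (fst (\<phi> s))) * (fst (\<phi> s) \<bullet> snd (\<phi> s)))
        + (fst (\<phi> s) \<bullet> snd (\<phi> s) + snd (\<phi> s) \<bullet> fst (\<phi> s)) * (snd (\<phi> s) \<bullet> snd (\<phi> s)))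
        (at s within {0..<b})"
      using DERIV_mult'[OF DERIV_inner[OF d(1) d(1)] d(5)] .
    from DERIV_diff[OF this DERIV_power[OF d(4), of 2]]
    show ?thesis unfolding ang_mom2_def
      by (rule DERIV_cong) (rule alg[OF dot_square_norm inner_commute pos])
  qed
  from has_field_derivative_zero_constant[OF _ this]
  obtain c where c: "\<And>s. s \<in> {0..<b} \<Longrightarrow> ang_mom2 (\<phi> s) = c" by auto
  show ?thesis using c[of t] c[of 0] assms(2,3) solution_onD(1,2)[OF assms(1)] by simp
qed

lemma kinetic_energy:
  assumes "solution_on V y b \<phi>" "0 \<le> t" "t < b"
  shows "snd (\<phi> t) \<bullet> snd (\<phi> t) = 2 * (energy V y + V (norm (fst (\<phi> t))))"
proof -
  have "a = 2 * (e + c)" if "a / 2 - c = e" for a c e :: real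
    using that by (simp add: field_simps)
  from this[OF energy_conserved[OF assms, unfolded energy_def[of V "\<phi> t"]]] show ?thesis .
qed

text \<open>With \<open>w = v/|v|\<close> and \<open>S\<close> the cosine of the angle between \<open>x\<close> and \<open>v\<close>, the point is the
  inequality \<open>|w'| \<le> 2 \<eta> (arcsin S)'\<close>; the right-hand side has a bounded integral.\<close>

lemma velocity_turning:
  assumes \<phi>: "solution_on V y b \<phi>" and t: "0 \<le> t1" "t1 \<le> p" "p < b"
    and \<eta>: "0 < \<eta>" "\<eta> \<le> 1/2"
    and zone: "\<And>t. t1 \<le> t \<Longrightarrow> t \<le> p \<Longrightarrow> 0 < snd (\<phi> t) \<bullet> snd (\<phi> t)"
      "\<And>t. t1 \<le> t \<Longrightarrow> t \<le> p \<Longrightarrow>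
        \<bar>norm (fst (\<phi> t)) * deriv V (norm (fst (\<phi> t)))\<bar> \<le> \<eta> * (snd (\<phi> t) \<bullet> snd (\<phi> t))"
    and peri: "fst (\<phi> p) \<bullet> snd (\<phi> p) = 0"
  shows "norm (sgn (snd (\<phi> p)) - sgn (snd (\<phi> t1))) \<le> 4 * \<eta>"
proof (cases "t1 = p")
  case False
  then have "t1 < p" using t by simp
  define l where "l = sqrt (ang_mom2 y)"
  define r n q h where "r t = norm (fst (\<phi> t))" and "n t = norm (snd (\<phi> t))"
    and "q t = fst (\<phi> t) \<bullet> snd (\<phi> t)" and "h t = deriv V (r t)" for t
  define w' where "w' t = (1 / n t) *\<^sub>R ((h t / r t) *\<^sub>R fst (\<phi> t)) +
      (- (h t / r t * q t) / n t ^ 3) *\<^sub>R snd (\<phi> t)" for t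
  have q_fun: "q = (\<lambda>t. fst (\<phi> t) \<bullet> snd (\<phi> t))" and r_fun: "r = (\<lambda>t. norm (fst (\<phi> t)))"
    by (simp_all add: fun_eq_iff q_def r_def)
  have rn: "r t > 0" "n t > 0" if "t1 \<le> t" "t \<le> p" for t
    using solution_onD(3)[OF \<phi>, of t] zone(1)[OF that] that assms by (auto simp: r_def n_def)
  have n2: "snd (\<phi> t) \<bullet> snd (\<phi> t) = (n t)\<^sup>2" "fst (\<phi> t) \<bullet> fst (\<phi> t) = (r t)\<^sup>2" for t
    by (simp_all add: n_def r_def dot_square_norm)
  have L: "(r t)\<^sup>2 * (n t)\<^sup>2 - (q t)\<^sup>2 = ang_mom2 y" if "t1 \<le> t" "t \<le> p" for t
    using ang_mom2_conserved[OF \<phi>, of t] that assms by (simp add: ang_mom2_def q_def n2)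
  \<comment> \<open>At \<open>p\<close> position and velocity are orthogonal and nonzero. The
    angular momentum is therefore nonzero all along, which keeps the cosine \<open>S\<close>
    strictly between -1 and 1, where arcsin is differentiable.\<close>
  have Lpos: "ang_mom2 y > 0" using L[of p] peri zero_less_power[OF rn(1), of p 2] zero_less_power[OF rn(2), of p 2] t
    by (simp add: q_def flip: L)
  have l: "l > 0" "l\<^sup>2 = ang_mom2 y" using Lpos by (auto simp: l_def)
  have deriv: "((\<lambda>t. sgn (snd (\<phi> t))) has_vector_derivative w' t) (at t within {0..<b})"
    "((\<lambda>t. arcsin (q t / (r t * n t))) has_real_derivative
        ((n t)\<^sup>2 + r t * h t) * l / (r t * n t)\<^sup>2) (at t within {0..<b})"
    if tt: "t1 \<le> t" "t \<le> p" for t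
  proof -
    have tb: "0 \<le> t" "t < b" using tt t by auto
    note d = solution_deriv[OF \<phi> tb, folded r_def q_def]
    note pos = rn[OF tt]
    have v0: "snd (\<phi> t) \<noteq> 0" using pos by (auto simp: n_def)
    have dn: "(n has_real_derivative h t / r t * q t / n t) (at t within {0..<b})"
      using DERIV_norm[OF d(2) v0] unfolding n_def
      by (rule DERIV_cong) (simp add: q_def h_def r_def inner_commute)
    have "((\<lambda>t. 1 / n t) has_real_derivative - (h t / r t * q t) / n t ^ 3) (at t within {0..<b})"
      unfolding inverse_eq_divide[symmetric]
      by (rule DERIV_cong[OF DERIV_inverse'[OF dn]]) (use pos in \<open>simp_all add: power3_eq_cube field_simps\<close>)
    from has_vector_derivative_scaleR[OF this d(2)]
    show "((\<lambda>t. sgn (snd (\<phi> t))) has_vector_derivative w' t) (at t within {0..<b})"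
      by (simp add: sgn_div_norm n_def w'_def h_def r_def inverse_eq_divide)
    define s where "s = q t / (r t * n t)"
    have rn2: "(r t * n t)\<^sup>2 = (q t)\<^sup>2 + l\<^sup>2" using L[OF tt] l by (simp add: power_mult_distrib)
    \<comment> \<open>The squared sine of the angle between position and velocity, by Lagrange's
      identity.\<close>
    have s2: "1 - s\<^sup>2 = (l / (r t * n t))\<^sup>2"
    proof -
      have "1 - s\<^sup>2 = ((r t * n t)\<^sup>2 - (q t)\<^sup>2) / (r t * n t)\<^sup>2"
        using pos by (simp add: s_def power_divide diff_divide_distrib)
      also have "\<dots> = l\<^sup>2 / (r t * n t)\<^sup>2" unfolding rn2 by simp
      finally show ?thesis by (simp add: power_divide)
    qed
    have s1: "-1 < s" "s < 1"
    proof -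
      have "0 < 1 - s\<^sup>2" unfolding s2 using l pos by simp
      then have "s\<^sup>2 < 1\<^sup>2" by simp
      then have "\<bar>s\<bar> < 1" using power2_less_imp_less[of "\<bar>s\<bar>" 1] by simp
      then show "-1 < s" "s < 1" by auto
    qed
    have sq: "sqrt (1 - s\<^sup>2) = l / (r t * n t)" using s2 l pos by simp
    have dq: "(q has_real_derivative (n t)\<^sup>2 + r t * h t) (at t within {0..<b})"
      using d(4) unfolding q_fun by (simp add: n2 r_def h_def)
    have dr: "(r has_real_derivative q t / r t) (at t within {0..<b})"
      using d(3) unfolding r_fun by (simp add: q_def r_def)
    have ds: "((\<lambda>t. q t / (r t * n t)) has_real_derivative ((n t)\<^sup>2 + r t * h t) * l\<^sup>2 / (r t * n t)^3)
        (at t within {0..<b})"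
    proof (rule DERIV_cong[OF DERIV_divide[OF dq DERIV_mult[OF dr dn]]])
      show "r t * n t \<noteq> 0" using pos by simp
      have 1: "q t / r t * n t + h t / r t * q t / n t * r t = q t * ((n t)\<^sup>2 + r t * h t) / (r t * n t)"
        using pos by (simp add: field_simps power2_eq_square)
      have 2: "(A * R - q t * (q t * A / R)) / (R * R) = A * (R\<^sup>2 - (q t)\<^sup>2) / R ^ 3" if "R > 0" for A R :: real
        using that by (simp add: field_simps power2_eq_square power3_eq_cube)
      show "(((n t)\<^sup>2 + r t * h t) * (r t * n t) - q t * (q t / r t * n t + h t / r t * q t / n t * r t)) /
          (r t * n t * (r t * n t)) = ((n t)\<^sup>2 + r t * h t) * l\<^sup>2 / (r t * n t) ^ 3"
        unfolding 1 using 2[of "r t * n t" "(n t)\<^sup>2 + r t * h t"] pos rn2 by simp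
    qed
    have "(arcsin has_real_derivative inverse (sqrt (1 - s\<^sup>2))) (at (q t / (r t * n t)))"
      using DERIV_arcsin[OF s1] by (simp add: s_def)
    from DERIV_chain2[where g = "\<lambda>t. q t / (r t * n t)", OF this ds]
    show "((\<lambda>t. arcsin (q t / (r t * n t))) has_real_derivative
        ((n t)\<^sup>2 + r t * h t) * l / (r t * n t)\<^sup>2) (at t within {0..<b})"
    proof (rule DERIV_cong)
      have alg: "inverse (k / R) * (A * k\<^sup>2 / R ^ 3) = A * k / R\<^sup>2" if "k > 0" "R > 0" for k R A :: real
        using that by (simp add: power2_eq_square power3_eq_cube)
      show "inverse (sqrt (1 - s\<^sup>2)) * (((n t)\<^sup>2 + r t * h t) * l\<^sup>2 / (r t * n t) ^ 3)
          = ((n t)\<^sup>2 + r t * h t) * l / (r t * n t)\<^sup>2"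
        unfolding sq by (rule alg[OF l(1) mult_pos_pos[OF pos]])
    qed
  qed
  have bound: "norm (w' t) \<le> 2 * \<eta> * (((n t)\<^sup>2 + r t * h t) * l / (r t * n t)\<^sup>2)"
    if tt: "t1 \<le> t" "t \<le> p" for t
  proof -
    note pos = rn[OF tt]
    \<comment> \<open>\<open>w'\<close> is a multiple of the component of the position orthogonal to
      the velocity, and that component has length \<open>l / n t\<close>.\<close>
    have "(norm (w' t))\<^sup>2 = (\<bar>h t\<bar> * l / (r t * (n t)\<^sup>2))\<^sup>2"
    proof -
      have "w' t = (h t / (r t * n t)) *\<^sub>R (fst (\<phi> t) - (q t / (n t)\<^sup>2) *\<^sub>R snd (\<phi> t))"
        using pos by (simp add: w'_def algebra_simps power2_eq_square power3_eq_cube)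
      then have "(norm (w' t))\<^sup>2 = (h t / (r t * n t))\<^sup>2 * (norm (fst (\<phi> t) - (q t / (n t)\<^sup>2) *\<^sub>R snd (\<phi> t)))\<^sup>2"
        by (simp add: power_mult_distrib power_divide)
      also have "(norm (fst (\<phi> t) - (q t / (n t)\<^sup>2) *\<^sub>R snd (\<phi> t)))\<^sup>2
          = (r t)\<^sup>2 - 2 * (q t / (n t)\<^sup>2) * q t + (q t / (n t)\<^sup>2)\<^sup>2 * (n t)\<^sup>2"
        unfolding power2_norm_eq_inner
        by (simp add: algebra_simps n2 q_def inner_commute power2_eq_square)
      also have "\<dots> = ((r t)\<^sup>2 * (n t)\<^sup>2 - (q t)\<^sup>2) / (n t)\<^sup>2"
      proof -
        have "R - 2 * (Q / N) * Q + (Q / N)\<^sup>2 * N = (R * N - Q\<^sup>2) / N" if "N > 0" for R Q N :: real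
          using that by (simp add: field_simps power2_eq_square)
        then show ?thesis using pos by simp
      qed
      also have "\<dots> = l\<^sup>2 / (n t)\<^sup>2" unfolding L[OF tt] l(2) ..
      finally show ?thesis
        by (simp add: power_mult_distrib power_divide mult_ac power2_eq_square[of "(n t)\<^sup>2"])
    qed
    then have "norm (w' t) = \<bar>h t\<bar> * l / (r t * (n t)\<^sup>2)"
      by (rule power2_eq_imp_eq) (use l pos in simp_all)
    also have "\<dots> = (r t * \<bar>h t\<bar>) * (l / (r t * n t)\<^sup>2)"
      using pos by (simp add: power2_eq_square)
    also have "\<dots> \<le> (2 * \<eta> * ((n t)\<^sup>2 + r t * h t)) * (l / (r t * n t)\<^sup>2)"
    proof (rule mult_right_mono)
      \<comment> \<open>Because \<open>\<eta> \<le> 1/2\<close>, the virial expression is at least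
        half of the squared speed; this is the source of the factor 2 in the bound.\<close>
      have z: "\<bar>r t * h t\<bar> \<le> \<eta> * (n t)\<^sup>2" using zone(2)[OF tt] by (simp add: n2 r_def h_def)
      also have "\<dots> \<le> 1/2 * (n t)\<^sup>2" using \<eta> by (intro mult_right_mono) auto
      finally have "(n t)\<^sup>2 \<le> 2 * ((n t)\<^sup>2 + r t * h t)" by (simp add: abs_le_iff)
      then have "\<eta> * (n t)\<^sup>2 \<le> \<eta> * (2 * ((n t)\<^sup>2 + r t * h t))" using \<eta> by (intro mult_left_mono) auto
      then show "r t * \<bar>h t\<bar> \<le> 2 * \<eta> * ((n t)\<^sup>2 + r t * h t)"
        using z pos by (simp add: abs_mult algebra_simps)
    qed (use l in simp)
    finally show ?thesis by simp
  qed
  have int: "at t within {0..<b} = at t" if "t1 < t" "t < p" for t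
    by (rule at_within_interior) (use that t in auto)
  have "norm (sgn (snd (\<phi> p)) - sgn (snd (\<phi> t1)))
      \<le> 2 * \<eta> * arcsin (q p / (r p * n p)) - 2 * \<eta> * arcsin (q t1 / (r t1 * n t1))"
  proof (rule differentiable_bound_general[OF \<open>t1 < p\<close>, where f' = w'
        and \<phi>' = "\<lambda>t. 2 * \<eta> * (((n t)\<^sup>2 + r t * h t) * l / (r t * n t)\<^sup>2)"])
    have sub: "{t1..p} \<subseteq> {0..<b}" using t by auto
    show "continuous_on {t1..p} (\<lambda>t. sgn (snd (\<phi> t)))"
      using sub by (auto simp: continuous_on_eq_continuous_within
          intro!: has_vector_derivative_continuous has_vector_derivative_within_subset[OF deriv(1)])
    show "continuous_on {t1..p} (\<lambda>t. 2 * \<eta> * arcsin (q t / (r t * n t)))"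
    proof (intro continuous_on_mult_left, rule DERIV_continuous_on)
      fix t assume "t \<in> {t1..p}"
      then show "((\<lambda>t. arcsin (q t / (r t * n t))) has_real_derivative
          ((n t)\<^sup>2 + r t * h t) * l / (r t * n t)\<^sup>2) (at t within {t1..p})"
        using sub by (intro DERIV_subset[OF deriv(2)]) auto
    qed
    fix t assume tt: "t1 < t" "t < p"
    show "((\<lambda>t. sgn (snd (\<phi> t))) has_vector_derivative w' t) (at t)"
      using deriv(1)[of t] tt int[OF tt] by simp
    show "((\<lambda>t. 2 * \<eta> * arcsin (q t / (r t * n t))) has_vector_derivative
        2 * \<eta> * (((n t)\<^sup>2 + r t * h t) * l / (r t * n t)\<^sup>2)) (at t)"
      using DERIV_cmult[OF deriv(2)[of t], of "2 * \<eta>"] tt int[OF tt]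
      by (simp add: has_real_derivative_iff_has_vector_derivative)
    show "norm (w' t) \<le> 2 * \<eta> * (((n t)\<^sup>2 + r t * h t) * l / (r t * n t)\<^sup>2)"
      using bound[of t] tt by simp
  qed
  also have "q p = 0" using peri by (simp add: q_def)
  finally have 1: "norm (sgn (snd (\<phi> p)) - sgn (snd (\<phi> t1))) \<le> 2 * \<eta> * (- arcsin (q t1 / (r t1 * n t1)))"
    by simp
  have "\<bar>q t1\<bar> \<le> r t1 * n t1" unfolding q_def r_def n_def by (rule Cauchy_Schwarz_ineq2)
  then have "-1 \<le> q t1 / (r t1 * n t1)" "q t1 / (r t1 * n t1) \<le> 1"
    using rn[of t1] t by (auto simp: field_simps)
  \<comment> \<open>The arcsin vanishes at the pericenter and starts no lower than -pi/2, which is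
    rounded to -2; hence the total \<open>4 * \<eta>\<close>.\<close>
  from arcsin_lbound[OF this] have "- arcsin (q t1 / (r t1 * n t1)) \<le> 2"
    using pi_less_4 by linarith
  then have "2 * \<eta> * (- arcsin (q t1 / (r t1 * n t1))) \<le> 2 * \<eta> * 2"
    using \<eta> by (intro mult_left_mono) auto
  with 1 show ?thesis by simp
qed (use \<eta> in simp)

end

section \<open>Passage near the center\<close>

text \<open>For a unit vector \<open>e\<close> this is the symmetry of the flow that reverses time and reflects the
  positions in the axis \<open>e\<close>; for \<open>e = 0\<close> it is the map used for transmission.\<close>

definition reflect :: "real^2 \<Rightarrow> phase \<Rightarrow> phase" where
  "reflect e y = ((2 * (fst y \<bullet> e)) *\<^sub>R e - fst y, snd y - (2 * (snd y \<bullet> e)) *\<^sub>R e)"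

lemma bounded_linear_reflect: "bounded_linear (reflect e)"
  unfolding reflect_def
  by (intro bounded_linear_Pair bounded_linear_sub bounded_linear_compose[OF bounded_linear_scaleR_left]
      bounded_linear_compose[OF bounded_linear_mult_right] bounded_linear_compose[OF bounded_linear_inner_left]
      bounded_linear_fst bounded_linear_snd)

lemma transmission_eq_reflect: "transmission T0 \<phi> t = reflect 0 (\<phi> (2 * T0 - t))"
  by (simp add: transmission_def reflect_def)

lemma norm_fst_reflect:
  assumes "e = 0 \<or> norm e = 1"
  shows "norm (fst (reflect e y)) = norm (fst y)"
proof -
  have "e \<bullet> e = 1 \<or> e = 0" using assms by (auto simp: dot_square_norm)
  then have "fst (reflect e y) \<bullet> fst (reflect e y) = fst y \<bullet> fst y"
    by (auto simp: reflect_def algebra_simps inner_commute)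
  then show ?thesis by (simp add: norm_eq)
qed

text \<open>The position lies on the axis and the velocity is orthogonal to it. Being a fixed point
  is what lets the mirror image be glued to the incoming half.\<close>

lemma reflect_pericenter:
  assumes "fst y \<bullet> snd y = 0"
  shows "reflect (sgn (fst y)) y = y"
  using assms
  by (cases y) (auto simp: reflect_def sgn_div_norm inner_commute power2_norm_eq_inner[symmetric]
      power2_eq_square prod_eq_iff scaleR_2[symmetric] field_simps)

text \<open>The maps for \<open>e\<close> and for 0 differ by twice the projection onto
  \<open>e\<close>, which is small only on the line of \<open>u\<close>. Hence the comparison state
  must be radial, and the deviation of \<open>a\<close> from it is charged to the operator
  norm.\<close>

lemma norm_reflect_diff_le:
  assumes e: "norm e \<le> 1" "\<bar>e \<bullet> u\<bar> \<le> \<epsilon>"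
  shows "norm (reflect e a - reflect 0 (\<alpha> *\<^sub>R u, \<beta> *\<^sub>R u)) \<le> 6 * norm (a - (\<alpha> *\<^sub>R u, \<beta> *\<^sub>R u)) + 2 * (\<bar>\<alpha>\<bar> + \<bar>\<beta>\<bar>) * \<epsilon>"
proof -
  define d where "d = a - (\<alpha> *\<^sub>R u, \<beta> *\<^sub>R u)"
  have *: "norm ((2 * (x \<bullet> e)) *\<^sub>R e) \<le> 2 * \<bar>x \<bullet> e\<bar>" for x
    using mult_left_mono[OF e(1), of "2 * \<bar>x \<bullet> e\<bar>"] by (simp add: abs_mult)
  have **: "\<bar>x \<bullet> e\<bar> \<le> norm x" for x
    using Cauchy_Schwarz_ineq2[of x e] mult_left_mono[OF e(1), of "norm x"] by simp
  \<comment> \<open>Each of the two components contributes at most three times the norm: one for the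
    identity, two for the projection term.\<close>
  have 1: "norm (reflect e d) \<le> 6 * norm d"
  proof -
    have f: "norm (fst d) \<le> norm d" "norm (snd d) \<le> norm d"
      using norm_fst_diff_le[of d 0] norm_snd_diff_le[of d 0] by auto
    have "norm (reflect e d) \<le> norm ((2 * (fst d \<bullet> e)) *\<^sub>R e - fst d) + norm (snd d - (2 * (snd d \<bullet> e)) *\<^sub>R e)"
      unfolding reflect_def by (rule norm_Pair_le)
    also have "\<dots> \<le> (2 * norm d + norm d) + (norm d + 2 * norm d)"
      using *[of "fst d"] *[of "snd d"] **[of "fst d"] **[of "snd d"] f
      by (intro add_mono order_trans[OF norm_triangle_ineq4]) simp_all
    finally show ?thesis by simp
  qed
  have 2: "norm ((2 * ((\<alpha> *\<^sub>R u) \<bullet> e)) *\<^sub>R e, - (2 * ((\<beta> *\<^sub>R u) \<bullet> e)) *\<^sub>R e) \<le> 2 * (\<bar>\<alpha>\<bar> + \<bar>\<beta>\<bar>) * \<epsilon>"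
  proof -
    have e2: "\<bar>u \<bullet> e\<bar> \<le> \<epsilon>" using e by (simp add: inner_commute)
    have "norm ((2 * ((\<alpha> *\<^sub>R u) \<bullet> e)) *\<^sub>R e, - (2 * ((\<beta> *\<^sub>R u) \<bullet> e)) *\<^sub>R e)
        \<le> norm ((2 * ((\<alpha> *\<^sub>R u) \<bullet> e)) *\<^sub>R e) + norm (- (2 * ((\<beta> *\<^sub>R u) \<bullet> e)) *\<^sub>R e)"
      by (rule norm_Pair_le)
    also have "\<dots> \<le> 2 * \<bar>(\<alpha> *\<^sub>R u) \<bullet> e\<bar> + 2 * \<bar>(\<beta> *\<^sub>R u) \<bullet> e\<bar>"
      using *[of "\<alpha> *\<^sub>R u"] *[of "\<beta> *\<^sub>R u"] by (intro add_mono) simp_all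
    also have "\<dots> = 2 * (\<bar>\<alpha>\<bar> + \<bar>\<beta>\<bar>) * \<bar>u \<bullet> e\<bar>" by (simp add: abs_mult algebra_simps)
    also have "\<dots> \<le> 2 * (\<bar>\<alpha>\<bar> + \<bar>\<beta>\<bar>) * \<epsilon>" using e2 by (intro mult_left_mono) auto
    finally show ?thesis .
  qed
  have "reflect e a - reflect 0 (\<alpha> *\<^sub>R u, \<beta> *\<^sub>R u)
      = reflect e d + ((2 * ((\<alpha> *\<^sub>R u) \<bullet> e)) *\<^sub>R e, - (2 * ((\<beta> *\<^sub>R u) \<bullet> e)) *\<^sub>R e)"
    by (simp add: reflect_def d_def inner_diff_left algebra_simps)
  with norm_triangle_mono[OF 1 2] show ?thesis by (simp add: d_def)
qed

context smooth_potential
begin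

text \<open>The minus sign is the reversal of time. The symmetry holds because the force coefficient
  depends on the radius alone, which \<open>reflect\<close> preserves.\<close>

lemma vector_field_reflect:
  assumes "e = 0 \<or> norm e = 1" "fst y \<noteq> 0"
  shows "vector_field V (reflect e y) = reflect e (- vector_field V y)"
proof -
  have "fst (reflect e y) \<noteq> 0" using norm_fst_reflect[OF assms(1), of y] assms(2) by auto
  then show ?thesis
    using assms(2) norm_fst_reflect[OF assms(1), of y]
    by (simp add: vector_field_eq[OF smooth]) (simp add: reflect_def algebra_simps)
qed

lemma reflect_deriv:
  assumes "e = 0 \<or> norm e = 1" "fst (\<phi> (2 * p - t)) \<noteq> 0"
    and "(\<phi> has_vector_derivative vector_field V (\<phi> (2 * p - t))) (at (2 * p - t))"
  shows "((\<lambda>t. reflect e (\<phi> (2 * p - t))) has_vector_derivative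
    vector_field V (reflect e (\<phi> (2 * p - t)))) (at t within A)"
proof -
  have "((\<lambda>t. 2 * p - t) has_vector_derivative -1) (at t)"
    by (auto intro!: derivative_eq_intros simp: has_real_derivative_iff_has_vector_derivative[symmetric])
  from vector_diff_chain_at[OF this assms(3)]
  have "((\<lambda>t. \<phi> (2 * p - t)) has_vector_derivative - vector_field V (\<phi> (2 * p - t))) (at t)"
    by (simp add: o_def)
  from bounded_linear.has_vector_derivative[OF bounded_linear_reflect this] show ?thesis
    unfolding vector_field_reflect[OF assms(1,2)] by (rule has_vector_derivative_at_within)
qed

text \<open>The mirror image of the incoming half extends the lifetime to \<open>2 * p\<close>,
  however little \<open>b\<close> exceeds \<open>p\<close>. At the seam the values agree, and with
  them the derivatives, since both are given by the vector field.\<close>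

lemma solution_past_pericenter:
  assumes \<phi>: "solution_on V y b \<phi>" and p: "0 < p" "p < b" and peri: "fst (\<phi> p) \<bullet> snd (\<phi> p) = 0"
  defines "e \<equiv> sgn (fst (\<phi> p))"
  shows "solution_on V y (2 * p) (\<lambda>t. if t \<in> {0..p} then \<phi> t else reflect e (\<phi> (2 * p - t)))"
    (is "solution_on V y (2 * p) ?\<psi>")
proof -
  have e: "e = 0 \<or> norm e = 1" by (auto simp: e_def norm_sgn)
  have refl: "reflect e (\<phi> p) = \<phi> p" unfolding e_def by (rule reflect_pericenter[OF peri])
  have d2: "((\<lambda>t. reflect e (\<phi> (2 * p - t))) has_vector_derivative
    vector_field V (reflect e (\<phi> (2 * p - t)))) (at t within A)" if "p \<le> t" "t < 2 * p" for t A
    using that p by (intro reflect_deriv[OF e] solution_onD(3)[OF \<phi>] solution_onD(5)[OF \<phi>]) auto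
  have cl: "closure {p<..<2 * p} = {p..2 * p}" using p by simp
  have cc: "closure {0..p} \<inter> closure {p<..<2 * p} = {p}" unfolding cl using p by auto
  show ?thesis
    unfolding solution_on_def
  proof (intro conjI ballI)
    show "0 < 2 * p" "?\<psi> 0 = y" using p solution_onD(2)[OF \<phi>] by auto
    fix t assume t: "t \<in> {0..<2 * p}"
    show "fst (?\<psi> t) \<noteq> 0"
    proof (cases "t \<le> p")
      case True
      then show ?thesis using t p solution_onD(3)[OF \<phi>, of t] by auto
    next
      case False
      then have "norm (fst (?\<psi> t)) = norm (fst (\<phi> (2 * p - t)))" using norm_fst_reflect[OF e] by simp
      then show ?thesis using False t p solution_onD(3)[OF \<phi>, of "2 * p - t"] by auto
    qed
    have "(?\<psi> has_vector_derivative (if t \<in> {0..p} then vector_field V (\<phi> t)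
        else vector_field V (reflect e (\<phi> (2 * p - t))))) (at t within {0..<2 * p})"
    proof (rule has_vector_derivative_If_within_closures[where T = "{p<..<2 * p}"], goal_cases)
      case 1 then show ?case using t by auto
    next
      case 2 then show ?case using p by auto
    next
      case 3
      then have "t \<in> {0..p}" unfolding cc using p by auto
      then show ?case unfolding cc
        using p by (intro has_vector_derivative_within_subset[OF solution_onD(4)[OF \<phi>]]) auto
    next
      case 4
      then show ?case unfolding cc using p by (intro d2) auto
    next
      case 5
      then have "t = p" using cc by blast
      then show ?case using refl by simp
    next
      case 6
      then have "t = p" using cc by blast
      then show ?case using refl by simp
    qed
    then show "(?\<psi> has_vector_derivative vector_field V (?\<psi> t)) (at t within {0..<2 * p})"
      by (simp only: if_distrib[of "vector_field V"])
  qed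
qed

lemma flow_reaches_past_pericenter:
  assumes \<phi>: "solution_on V y b \<phi>" and p: "0 < p" "p < b" and peri: "fst (\<phi> p) \<bullet> snd (\<phi> p) = 0"
    and t: "p < t" "t < 2 * p"
  shows "flow_reaches V y t (reflect (sgn (fst (\<phi> p))) (\<phi> (2 * p - t)))"
  using Phi_solution(1)[OF solution_past_pericenter[OF \<phi> p peri], of t] t p by simp

end

context star_potential
begin

text \<open>A conserved quantity that is bounded by r^2 |v|^2 must vanish if the orbit reaches
  arbitrarily small radii.\<close>

lemma collision_ang_mom2:
  assumes "collision_solution V y T0 \<phi>"
  shows "ang_mom2 y = 0"
proof (rule ccontr)
  assume "ang_mom2 y \<noteq> 0"
  then have pos: "0 < ang_mom2 y" using ang_mom2_nonneg[of y] by simp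
  obtain r0 where r0: "0 < r0" "\<And>r. 0 < r \<Longrightarrow> r < r0 \<Longrightarrow> r\<^sup>2 * (2 * (energy V y + V r)) < ang_mom2 y"
    using r2_kinetic_tendsto_0[OF pos] by blast
  have \<phi>: "solution_on V y T0 \<phi>" and lim: "((\<lambda>t. fst (\<phi> t)) \<longlongrightarrow> 0) (at_left T0)"
    using assms by (auto simp: collision_solution_def)
  have "\<forall>\<^sub>F t in at_left T0. norm (fst (\<phi> t)) < r0"
    using tendstoD[OF lim r0(1)] by simp
  moreover have "\<forall>\<^sub>F t in at_left T0. t \<in> {0<..<T0}" by (rule eventually_at_left_real[OF solution_onD(1)[OF \<phi>]])
  ultimately have "\<forall>\<^sub>F t in at_left T0. norm (fst (\<phi> t)) < r0 \<and> t \<in> {0<..<T0}" by (rule eventually_conj)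
  then obtain t where t: "norm (fst (\<phi> t)) < r0" "0 < t" "t < T0"
    using eventually_happens'[of "at_left T0"] by (auto simp: trivial_limit_at_left_real)
  have "ang_mom2 y = ang_mom2 (\<phi> t)" using ang_mom2_conserved[OF \<phi>] t by simp
  also have "\<dots> \<le> (norm (fst (\<phi> t)))\<^sup>2 * (2 * (energy V y + V (norm (fst (\<phi> t)))))"
    using ang_mom2_le[of "\<phi> t" V] energy_conserved[OF \<phi>, of t] t by simp
  also have "\<dots> < ang_mom2 y" using r0(2) t solution_onD(3)[OF \<phi>, of t] by simp
  finally show False by simp
qed

text \<open>Zero angular momentum is the equality case of Cauchy-Schwarz, so the velocity is
  parallel to the position; then the direction of the position has derivative 0.\<close>

lemma collision_radial:
  assumes "collision_solution V y T0 \<phi>" "0 \<le> t" "t < T0"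
  shows "fst (\<phi> t) = norm (fst (\<phi> t)) *\<^sub>R sgn (fst y)"
    "snd (\<phi> t) = ((fst (\<phi> t) \<bullet> snd (\<phi> t)) / norm (fst (\<phi> t))) *\<^sub>R sgn (fst y)"
proof -
  have \<phi>: "solution_on V y T0 \<phi>" using assms by (simp add: collision_solution_def)
  have v: "snd (\<phi> s) = ((fst (\<phi> s) \<bullet> snd (\<phi> s)) / (norm (fst (\<phi> s)))\<^sup>2) *\<^sub>R fst (\<phi> s)"
    if s: "0 \<le> s" "s < T0" for s
  proof -
    define x v c where "x = fst (\<phi> s)" and "v = snd (\<phi> s)" and "c = (x \<bullet> v) / (x \<bullet> x)"
    have x: "x \<bullet> x \<noteq> 0" using solution_onD(3)[OF \<phi> s] by (simp add: x_def)
    have "ang_mom2 (\<phi> s) = 0" using ang_mom2_conserved[OF \<phi> s] collision_ang_mom2[OF assms(1)] by simp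
    then have "(x \<bullet> x) * (v \<bullet> v) = (x \<bullet> v)\<^sup>2" by (simp add: ang_mom2_def x_def v_def)
    then have "(v - c *\<^sub>R x) \<bullet> (v - c *\<^sub>R x) = 0"
      using x by (simp add: c_def inner_diff_left inner_diff_right inner_commute field_simps power2_eq_square)
    then have "v = c *\<^sub>R x" by simp
    then show ?thesis by (simp add: x_def v_def c_def dot_square_norm)
  qed
  have "((\<lambda>s. sgn (fst (\<phi> s))) has_vector_derivative 0) (at s within {0..<T0})" if "s \<in> {0..<T0}" for s
  proof -
    have s: "0 \<le> s" "s < T0" using that by auto
    note d = solution_deriv[OF \<phi> s]
    have pos: "norm (fst (\<phi> s)) \<noteq> 0" using solution_onD(3)[OF \<phi> s] by simp
    from has_vector_derivative_scaleR[OF DERIV_inverse'[OF d(3) pos] d(1)]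
    have "((\<lambda>s. sgn (fst (\<phi> s))) has_vector_derivative
      inverse (norm (fst (\<phi> s))) *\<^sub>R snd (\<phi> s)
      + (- (inverse (norm (fst (\<phi> s))) * (fst (\<phi> s) \<bullet> snd (\<phi> s) / norm (fst (\<phi> s))) *
          inverse (norm (fst (\<phi> s))))) *\<^sub>R fst (\<phi> s)) (at s within {0..<T0})"
      by (simp add: sgn_div_norm)
    also have "inverse (norm (fst (\<phi> s))) *\<^sub>R snd (\<phi> s)
      = (inverse (norm (fst (\<phi> s))) * (fst (\<phi> s) \<bullet> snd (\<phi> s) / norm (fst (\<phi> s))) *
          inverse (norm (fst (\<phi> s)))) *\<^sub>R fst (\<phi> s)"
      by (subst v[OF s]) (simp add: power2_eq_square divide_inverse)
    finally show ?thesis by (simp flip: scaleR_add_left)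
  qed
  from has_vector_derivative_zero_constant[OF _ this]
  obtain c where c: "\<And>s. s \<in> {0..<T0} \<Longrightarrow> sgn (fst (\<phi> s)) = c" by auto
  have u: "sgn (fst (\<phi> t)) = sgn (fst y)"
    using c[of t] c[of 0] assms solution_onD(1,2)[OF \<phi>] by simp
  show x: "fst (\<phi> t) = norm (fst (\<phi> t)) *\<^sub>R sgn (fst y)"
    unfolding u[symmetric] using solution_onD(3)[OF \<phi> assms(2,3)] by (simp add: sgn_div_norm)
  have "snd (\<phi> t) = ((fst (\<phi> t) \<bullet> snd (\<phi> t)) / (norm (fst (\<phi> t)))\<^sup>2) *\<^sub>R (norm (fst (\<phi> t)) *\<^sub>R sgn (fst y))"
    using v[OF assms(2,3)] unfolding x[symmetric] .
  then show "snd (\<phi> t) = ((fst (\<phi> t) \<bullet> snd (\<phi> t)) / norm (fst (\<phi> t))) *\<^sub>R sgn (fst y)"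
    using solution_onD(3)[OF \<phi> assms(2,3)] by (simp add: power2_eq_square)
qed

text \<open>Otherwise the radius would be nondecreasing near \<open>T0\<close> and could not tend to
  0. It supplies an arbitrarily late time from which the encounter can be observed.\<close>

lemma collision_incoming:
  assumes "collision_solution V y T0 \<phi>" "0 \<le> s" "s < T0"
  obtains t where "s < t" "t < T0" "fst (\<phi> t) \<bullet> snd (\<phi> t) < 0"
proof (rule ccontr)
  assume "\<not> thesis"
  then have nn: "fst (\<phi> t) \<bullet> snd (\<phi> t) \<ge> 0" if "s < t" "t < T0" for t
    using that \<open>\<And>t. s < t \<Longrightarrow> t < T0 \<Longrightarrow> fst (\<phi> t) \<bullet> snd (\<phi> t) < 0 \<Longrightarrow> thesis\<close>[of t] by force
  have \<phi>: "solution_on V y T0 \<phi>" and lim: "((\<lambda>t. fst (\<phi> t)) \<longlongrightarrow> 0) (at_left T0)"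
    using assms by (auto simp: collision_solution_def)
  define c where "c = (s + T0) / 2"
  have c: "s < c" "c < T0" using assms by (auto simp: c_def)
  have mono: "norm (fst (\<phi> c)) \<le> norm (fst (\<phi> t))" if t: "c \<le> t" "t < T0" for t
  proof (rule DERIV_nonneg_imp_nondecreasing[where f = "\<lambda>t. norm (fst (\<phi> t))", OF t(1)])
    fix z assume z: "c \<le> z" "z \<le> t"
    have "at z within {0..<T0} = at z" by (rule at_within_interior) (use z c t assms in auto)
    then have "((\<lambda>t. norm (fst (\<phi> t))) has_real_derivative (fst (\<phi> z) \<bullet> snd (\<phi> z)) / norm (fst (\<phi> z))) (at z)"
      using solution_deriv(3)[OF \<phi>, of z] z c t assms by simp
    then show "\<exists>d. ((\<lambda>t. norm (fst (\<phi> t))) has_real_derivative d) (at z) \<and> 0 \<le> d"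
      using nn[of z] z c t by (intro exI[of _ "(fst (\<phi> z) \<bullet> snd (\<phi> z)) / norm (fst (\<phi> z))"]) auto
  qed
  have "((\<lambda>t. norm (fst (\<phi> t))) \<longlongrightarrow> 0) (at_left T0)" using tendsto_norm[OF lim] by simp
  moreover have "\<forall>\<^sub>F t in at_left T0. norm (fst (\<phi> c)) \<le> norm (fst (\<phi> t))"
    using eventually_at_left_real[OF c(2)] by eventually_elim (use mono in auto)
  ultimately have "norm (fst (\<phi> c)) \<le> 0" by (rule tendsto_lowerbound) simp
  then show False using solution_onD(3)[OF \<phi>, of c] c assms by simp
qed


text \<open>Once the position is close to 0 and moving inwards, the virial identity
  \<open>(x \<bullet> v)' = v\<^sup>2 + r V'(r) \<ge> 1/2\<close> forces \<open>x \<bullet> v\<close> to reach 0, unless the solution collides before.\<close>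

lemma infall:
  assumes sol: "solution_on V z b \<psi>" and t: "0 \<le> t1" "t1 \<le> s" "s < b"
    and zone: "\<And>r. 0 < r \<Longrightarrow> r < r0 \<Longrightarrow> \<bar>r * deriv V r\<bar> \<le> \<eta> * (2 * (energy V z + V r))"
      "\<And>r. 0 < r \<Longrightarrow> r < r0 \<Longrightarrow> 1 \<le> 2 * (energy V z + V r)"
    and \<eta>: "\<eta> \<le> 1/2" and r0: "norm (fst (\<psi> t1)) < r0"
    and neg: "\<And>t. t1 < t \<Longrightarrow> t < s \<Longrightarrow> fst (\<psi> t) \<bullet> snd (\<psi> t) \<le> 0"
  shows "norm (fst (\<psi> s)) \<le> norm (fst (\<psi> t1))"
    and "(s - t1) / 2 \<le> fst (\<psi> s) \<bullet> snd (\<psi> s) - fst (\<psi> t1) \<bullet> snd (\<psi> t1)"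
proof -
  have sub: "{t1..s} \<subseteq> {0..<b}" using t by auto
  have int: "at u within {0..<b} = at u" if "t1 < u" "u < s" for u
    by (rule at_within_interior) (use that t in auto)
  have cont: "continuous_on {t1..u} \<psi>" if "u \<le> s" for u
    using that t by (intro continuous_on_subset[OF solution_onD(6)[OF sol]]) auto
  \<comment> \<open>As long as \<open>x \<bullet> v\<close> is nonpositive the radius does not grow,
    so the orbit stays where the estimates on \<open>V\<close> are available.\<close>
  have decr: "norm (fst (\<psi> u)) \<le> norm (fst (\<psi> t1))" if u: "t1 \<le> u" "u \<le> s" for u
  proof (rule DERIV_nonpos_imp_decreasing_open[of t1 u "\<lambda>u. norm (fst (\<psi> u))"])
    show "continuous_on {t1..u} (\<lambda>u. norm (fst (\<psi> u)))" by (intro continuous_intros cont u)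
    fix w assume w: "t1 < w" "w < u"
    have "((\<lambda>t. norm (fst (\<psi> t))) has_real_derivative (fst (\<psi> w) \<bullet> snd (\<psi> w)) / norm (fst (\<psi> w))) (at w)"
      using solution_deriv(3)[OF sol, of w] w u t int[of w] by simp
    then show "\<exists>d. ((\<lambda>t. norm (fst (\<psi> t))) has_real_derivative d) (at w) \<and> d \<le> 0"
      using neg[of w] w u by (intro exI[of _ "(fst (\<psi> w) \<bullet> snd (\<psi> w)) / norm (fst (\<psi> w))"]) (auto simp: divide_nonpos_nonneg)
  qed (rule u)
  show "norm (fst (\<psi> s)) \<le> norm (fst (\<psi> t1))" using decr t by simp
  have "fst (\<psi> t1) \<bullet> snd (\<psi> t1) - t1 / 2 \<le> fst (\<psi> s) \<bullet> snd (\<psi> s) - s / 2"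
  proof (rule DERIV_nonneg_imp_increasing_open[of t1 s "\<lambda>u. fst (\<psi> u) \<bullet> snd (\<psi> u) - u / 2"])
    show "continuous_on {t1..s} (\<lambda>u. fst (\<psi> u) \<bullet> snd (\<psi> u) - u / 2)"
      by (intro continuous_intros cont) simp_all
    fix u assume u: "t1 < u" "u < s"
    define r where "r = norm (fst (\<psi> u))"
    have r: "0 < r" "r < r0" using solution_onD(3)[OF sol, of u] decr[of u] u t r0 by (auto simp: r_def)
    have v: "snd (\<psi> u) \<bullet> snd (\<psi> u) = 2 * (energy V z + V r)"
      using kinetic_energy[OF sol, of u] u t by (simp add: r_def)
    have d: "((\<lambda>u. fst (\<psi> u) \<bullet> snd (\<psi> u)) has_real_derivative 2 * (energy V z + V r) + r * deriv V r) (at u)"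
      using solution_deriv(4)[OF sol, of u] u t int[of u] by (simp add: v flip: r_def)
    have "((\<lambda>u. fst (\<psi> u) \<bullet> snd (\<psi> u) - u / 2) has_real_derivative (2 * (energy V z + V r) + r * deriv V r - 1 / 2)) (at u)"
      by (rule DERIV_diff[OF d DERIV_cdivide[OF DERIV_ident]])
    moreover have "0 \<le> 2 * (energy V z + V r) + r * deriv V r - 1 / 2"
    proof -
      define W where "W = 2 * (energy V z + V r)"
      have W: "1 \<le> W" "\<bar>r * deriv V r\<bar> \<le> \<eta> * W" using zone[OF r] by (auto simp: W_def)
      have "\<eta> * W \<le> W / 2" using mult_right_mono[OF \<eta>, of W] W(1) by simp
      then have "- (r * deriv V r) \<le> W / 2" using W(2) by (simp add: abs_le_iff)
      then have "0 \<le> W + r * deriv V r - 1 / 2" using W(1) by simp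
      then show ?thesis unfolding W_def .
    qed
    ultimately show "\<exists>d. ((\<lambda>u. fst (\<psi> u) \<bullet> snd (\<psi> u) - u / 2) has_real_derivative d) (at u) \<and> 0 \<le> d" by blast
  qed (rule t)
  then show "(s - t1) / 2 \<le> fst (\<psi> s) \<bullet> snd (\<psi> s) - fst (\<psi> t1) \<bullet> snd (\<psi> t1)"
    by (simp add: diff_divide_distrib)
qed

text \<open>In the conclusion \<open>e = 0\<close> if the orbit of \<open>z\<close> collides at time \<open>p\<close>; otherwise \<open>p\<close> is the time and
  \<open>e\<close> the direction of its pericenter.\<close>

lemma passage:
  assumes coll: "collision_solution V y T0 \<phi>" and \<epsilon>: "0 < \<epsilon>"
  obtains \<delta> where "0 < \<delta>"
    "\<And>z. z \<in> ball y \<delta> \<Longrightarrow> \<exists>p e. \<bar>p - T0\<bar> < \<epsilon> \<and> norm e \<le> 1 \<and> \<bar>e \<bullet> sgn (fst y)\<bar> \<le> \<epsilon> \<and>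
       (\<forall>t. p < t \<and> t < 2 * p \<longrightarrow> flow_reaches V z t (reflect e (Phi V z (2 * p - t))))"
proof -
  define u \<phi>' where "u = sgn (fst y)" and "\<phi>' = Phi V y"
  have coll: "collision_solution V y T0 \<phi>'" unfolding \<phi>'_def by (rule collision_solution_Phi[OF coll])
  then have sol: "solution_on V y T0 \<phi>'" and lim: "((\<lambda>t. fst (\<phi>' t)) \<longlongrightarrow> 0) (at_left T0)"
    by (auto simp: collision_solution_def)
  have T0: "0 < T0" by (rule solution_onD(1)[OF sol])
  have y0: "fst y \<noteq> 0" using solution_onD(2)[OF sol] solution_onD(3)[OF sol, of 0] T0 by simp
  \<comment> \<open>The velocity turns by at most \<open>4 * \<eta>\<close>, hence by at most
    \<open>\<epsilon> / 4\<close>.\<close>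
  define \<eta> where "\<eta> = min (1/2) (\<epsilon> / 16)"
  have \<eta>: "0 < \<eta>" "\<eta> \<le> 1/2" "4 * \<eta> \<le> \<epsilon> / 4" using \<epsilon> by (auto simp: \<eta>_def)
  \<comment> \<open>A margin of 1 below the energy of the collision orbit makes this radius valid
    for all nearby orbits as well.\<close>
  obtain ra where ra: "0 < ra"
    "\<And>r E. 0 < r \<Longrightarrow> r < ra \<Longrightarrow> energy V y - 1 \<le> E \<Longrightarrow> \<bar>r * deriv V r\<bar> \<le> \<eta> * (2 * (E + V r))"
    "\<And>r E. 0 < r \<Longrightarrow> r < ra \<Longrightarrow> energy V y - 1 \<le> E \<Longrightarrow> 1 \<le> 2 * (E + V r)"
    using near_singularity[OF \<eta>(1), of "energy V y - 1"] by blast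
  \<comment> \<open>Below this radius \<open>x \<bullet> v\<close> exceeds
    \<open>- \<epsilon> / 8\<close>. Growing at rate at least 1/2, it needs at most time
    \<open>\<epsilon> / 4\<close> to reach 0.\<close>
  obtain rb where rb: "0 < rb" "\<And>r. 0 < r \<Longrightarrow> r < rb \<Longrightarrow> r\<^sup>2 * (2 * (energy V y + V r)) < (\<epsilon> / 8)\<^sup>2"
    using r2_kinetic_tendsto_0[of "(\<epsilon> / 8)\<^sup>2" "energy V y"] \<epsilon> by auto
  have "\<forall>\<^sub>F t in at_left T0. norm (fst (\<phi>' t)) < min ra rb"
    using tendstoD[OF lim, of "min ra rb"] ra rb by simp
  then obtain ts where ts: "ts < T0" "\<And>t. ts < t \<Longrightarrow> t < T0 \<Longrightarrow> norm (fst (\<phi>' t)) < min ra rb"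
    by (auto simp: eventually_at_left[OF T0])
  define tm where "tm = max (max 0 ts) (T0 - \<epsilon> / 2)"
  have "0 \<le> tm" "tm < T0" using ts T0 \<epsilon> by (auto simp: tm_def)
  from collision_incoming[OF coll this] obtain t1 where t1: "tm < t1" "t1 < T0" "fst (\<phi>' t1) \<bullet> snd (\<phi>' t1) < 0" .
  have t1': "0 < t1" "T0 - \<epsilon> / 2 < t1" "norm (fst (\<phi>' t1)) < ra" "norm (fst (\<phi>' t1)) < rb"
    using t1 ts(2)[of t1] by (auto simp: tm_def)
  define Y where "Y = \<phi>' t1"
  have Y: "fst Y \<noteq> 0" "snd Y \<noteq> 0" "fst Y \<bullet> snd Y < 0" "norm (fst Y) < ra"
    using t1 t1' solution_onD(3)[OF sol, of t1] by (auto simp: Y_def)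
  have EY: "energy V Y = energy V y" using energy_conserved[OF sol, of t1] t1 t1' by (simp add: Y_def)
  have qY: "- (\<epsilon> / 8) < fst Y \<bullet> snd Y"
  proof -
    have "(fst Y \<bullet> snd Y)\<^sup>2 \<le> (fst Y \<bullet> fst Y) * (snd Y \<bullet> snd Y)" by (rule Cauchy_Schwarz_ineq)
    also have "\<dots> = (norm (fst Y))\<^sup>2 * (2 * (energy V y + V (norm (fst Y))))"
      using kinetic_energy[OF sol, of t1] t1 t1' by (simp add: Y_def dot_square_norm)
    also have "\<dots> < (\<epsilon> / 8)\<^sup>2" using rb(2)[of "norm (fst Y)"] Y t1' by (simp add: Y_def)
    finally have "\<bar>fst Y \<bullet> snd Y\<bar> < \<epsilon> / 8" using \<epsilon> power2_less_imp_less[of "\<bar>fst Y \<bullet> snd Y\<bar>" "\<epsilon> / 8"] by simp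
    then show ?thesis by simp
  qed
  \<comment> \<open>The orbit is radial and incoming at \<open>t1\<close>, so its velocity points
    opposite to its position.\<close>
  have sgnY: "sgn (snd Y) = - u"
  proof -
    define \<beta> where "\<beta> = (fst Y \<bullet> snd Y) / norm (fst Y)"
    have "\<beta> < 0" using Y by (auto simp: \<beta>_def divide_neg_pos)
    moreover have "snd Y = \<beta> *\<^sub>R u"
      using collision_radial(2)[OF coll, of t1] t1 t1' by (simp add: Y_def \<beta>_def u_def)
    moreover have "norm u = 1" using y0 by (simp add: u_def norm_sgn)
    ultimately show ?thesis by (simp add: sgn_scaleR sgn_div_norm)
  qed
  have tid: "((\<lambda>z. z) \<longlongrightarrow> Y) (nhds Y)" by (rule filterlim_ident)
  have tE: "(energy V \<longlongrightarrow> energy V Y) (nhds Y)"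
    unfolding energy_def
    by (intro tendsto_intros isCont_tendsto_compose[OF DERIV_isCont[OF V_has_deriv]]) (use tid Y in auto)
  have "\<forall>\<^sub>F z in nhds Y. (fst z \<bullet> snd z < 0 \<and> - (\<epsilon> / 8) < fst z \<bullet> snd z) \<and>
      (norm (fst z) < ra \<and> energy V y - 1 < energy V z) \<and> dist (sgn (snd z)) (sgn (snd Y)) < \<epsilon> / 2"
    using Y qY \<epsilon>
    by (intro eventually_conj order_tendstoD(1)[OF tE] tendstoD[of "\<lambda>z. sgn (snd z)"]
        order_tendstoD(1)[of "\<lambda>z. fst z \<bullet> snd z" "fst Y \<bullet> snd Y"] order_tendstoD(2)[of "\<lambda>z. fst z \<bullet> snd z" "fst Y \<bullet> snd Y"]
        order_tendstoD(2)[of "\<lambda>z. norm (fst z)" "norm (fst Y)"] tendsto_intros tid) (auto simp: EY)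
  then obtain d1 where d1: "0 < d1" "\<And>z. dist z Y < d1 \<Longrightarrow> (fst z \<bullet> snd z < 0 \<and> - (\<epsilon> / 8) < fst z \<bullet> snd z) \<and>
      (norm (fst z) < ra \<and> energy V y - 1 < energy V z) \<and> dist (sgn (snd z)) (sgn (snd Y)) < \<epsilon> / 2"
    by (auto simp: eventually_nhds_metric)
  \<comment> \<open>The encounter takes place by \<open>t1 + \<epsilon> / 4\<close>, before the cap
    \<open>B\<close>. An orbit without a turning point therefore ends by genuine breakdown and not
    because of the cap. The auxiliary time \<open>c\<close> only has to lie strictly between
    \<open>t1\<close> and both \<open>T0\<close> and \<open>B\<close>.\<close>
  define B where "B = t1 + \<epsilon> / 2"
  define c where "c = (t1 + min T0 B) / 2"
  have c: "0 < c" "t1 < c" "c < T0" "c < B" using t1 t1' \<epsilon> by (auto simp: c_def B_def min_def)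
  obtain \<delta> where \<delta>: "0 < \<delta>" "\<And>z. z \<in> ball y \<delta> \<Longrightarrow> solution_on V z c (Phi V z)"
    "\<And>z s. z \<in> ball y \<delta> \<Longrightarrow> 0 \<le> s \<Longrightarrow> s < c \<Longrightarrow> dist (Phi V z s) (Phi V y s) < d1"
    using solution_nearby[OF sol c(1) c(3) d1(1)] by blast
  show ?thesis
  proof (rule that[OF \<delta>(1)], fold u_def)
    fix z assume z: "z \<in> ball y \<delta>"
    define \<psi> q where "\<psi> = Phi V z" and "q t = fst (\<psi> t) \<bullet> snd (\<psi> t)" for t
    have solc: "solution_on V z c \<psi>" using \<delta>(2)[OF z] by (simp add: \<psi>_def)
    have near: "q t1 < 0" "- (\<epsilon> / 8) < q t1" "norm (fst (\<psi> t1)) < ra" "energy V y - 1 < energy V (\<psi> t1)"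
      "dist (sgn (snd (\<psi> t1))) (- u) < \<epsilon> / 2"
      using d1(2)[of "\<psi> t1"] \<delta>(3)[OF z, of t1] t1' c
      by (auto simp: \<psi>_def q_def Y_def \<phi>'_def simp flip: sgnY)
    have Ez: "energy V y - 1 \<le> energy V z" using near(4) energy_conserved[OF solc, of t1] c t1' by simp
    note zone = ra(2)[OF _ _ Ez] ra(3)[OF _ _ Ez]
    obtain b where b: "c \<le> b" "b \<le> B" and solb: "solution_on V z b \<psi>"
      and leave: "\<And>\<epsilon>' M. b < B \<Longrightarrow> 0 < \<epsilon>' \<Longrightarrow> \<exists>t. 0 \<le> t \<and> t < b \<and> \<not> (\<epsilon>' \<le> norm (fst (\<psi> t)) \<and> norm (fst (\<psi> t)) \<le> M)"
      using maximal_solution[OF solc c(4)] unfolding \<psi>_def by metis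
    have fall: "norm (fst (\<psi> s)) \<le> norm (fst (\<psi> t1))" "(s - t1) / 2 \<le> q s - q t1"
      if "t1 \<le> s" "s < b" "\<And>t. t1 < t \<Longrightarrow> t < s \<Longrightarrow> q t \<le> 0" for s
      unfolding q_def
      by (rule infall[OF solb _ that(1,2) zone \<eta>(2) near(3)]; use that(3) t1' in \<open>simp add: q_def\<close>)+
    show "\<exists>p e. \<bar>p - T0\<bar> < \<epsilon> \<and> norm e \<le> 1 \<and> \<bar>e \<bullet> u\<bar> \<le> \<epsilon> \<and>
       (\<forall>t. p < t \<and> t < 2 * p \<longrightarrow> flow_reaches V z t (reflect e (Phi V z (2 * p - t))))"
    \<comment> \<open>If \<open>x \<bullet> v\<close> stays negative, the orbit of \<open>z\<close>
      collides at the end \<open>b\<close> of its life; otherwise its first zero is the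
      pericenter.\<close>
    proof (cases "\<exists>s\<in>{t1..<b}. 0 \<le> q s")
      case False
      then have neg: "q s < 0" if "t1 \<le> s" "s < b" for s using that by (auto simp: not_le)
      have "b \<le> t1 + \<epsilon> / 4"
      proof (rule ccontr)
        assume "\<not> ?thesis"
        then have s: "t1 \<le> t1 + \<epsilon> / 4" "t1 + \<epsilon> / 4 < b" using \<epsilon> by auto
        have "(t1 + \<epsilon> / 4 - t1) / 2 \<le> q (t1 + \<epsilon> / 4) - q t1"
          by (rule fall(2)[OF s]) (use neg s in \<open>force intro: less_imp_le\<close>)
        then show False using neg[OF s] near(2) by simp
      qed
      then have bB: "b < B" and bT: "\<bar>b - T0\<bar> < \<epsilon>" using \<epsilon> t1 t1' b c by (auto simp: B_def)
      have decr: "norm (fst (\<psi> t)) \<le> norm (fst (\<psi> s))" if "t1 \<le> s" "s \<le> t" "t < b" for s t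
      proof (rule infall(1)[OF solb _ that(2,3) zone \<eta>(2)])
        have "norm (fst (\<psi> s)) \<le> norm (fst (\<psi> t1))"
          by (rule fall(1)) (use that in \<open>auto intro!: less_imp_le[OF neg]\<close>)
        then show "norm (fst (\<psi> s)) < ra" using near(3) by simp
        show "0 \<le> s" using that t1' by simp
        show "fst (\<psi> x) \<bullet> snd (\<psi> x) \<le> 0" if "s < x" "x < t" for x
          using neg[of x] that \<open>t1 \<le> s\<close> \<open>t < b\<close> by (simp add: q_def)
      qed
      have "((\<lambda>t. fst (\<psi> t)) \<longlongrightarrow> 0) (at_left b)"
      proof (rule tendstoI)
        fix d :: real assume d: "0 < d"
        obtain \<epsilon>' M where ann: "0 < \<epsilon>'" "\<epsilon>' < M" "\<And>t. 0 \<le> t \<Longrightarrow> t \<le> t1 \<Longrightarrow> \<epsilon>' < norm (fst (\<psi> t)) \<and> norm (fst (\<psi> t)) < M"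
          using solution_annulus[OF solb, of t1] t1' c b by auto
        \<comment> \<open>The orbit leaves this annulus because it ends before the cap. It cannot do
          so up to \<open>t1\<close>, by the choice of the bounds, nor outwards later, as the radius
          does not grow; so the radius drops below \<open>d\<close> and stays there.\<close>
        obtain t where t: "0 \<le> t" "t < b" "\<not> (min \<epsilon>' d \<le> norm (fst (\<psi> t)) \<and> norm (fst (\<psi> t)) \<le> M)"
          using leave[OF bB, of "min \<epsilon>' d" M] ann(1) d by auto
        have tt: "t1 < t"
        proof (rule ccontr)
          assume "\<not> t1 < t"
          then show False using ann(3)[of t] t by auto
        qed
        have "norm (fst (\<psi> t)) \<le> M" using decr[of t1 t] tt t ann(3)[of t1] t1' by auto
        then have td: "norm (fst (\<psi> t)) < d" using t by auto
        show "\<forall>\<^sub>F s in at_left b. dist (fst (\<psi> s)) 0 < d"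
          using eventually_at_left_real[OF t(2)]
        proof eventually_elim
          case (elim s)
          then show ?case using decr[of t s] tt td by simp
        qed
      qed
      then have "collision_solution V z b \<psi>" using solb by (simp add: collision_solution_def)
      then have "flow_reaches V z t (reflect 0 (\<psi> (2 * b - t)))" if "b < t" "t < 2 * b" for t
        using Phi_collision(1)[OF _ that] by (simp add: transmission_eq_reflect)
      then show ?thesis using bT \<epsilon> by (intro exI[of _ b] exI[of _ 0]) (auto simp: \<psi>_def)
    next
      case True
      then obtain s0 where s0: "t1 \<le> s0" "s0 < b" "0 \<le> q s0" by auto
      have contq: "continuous_on {t1..s0} q"
        unfolding q_def using t1' s0
        by (intro continuous_intros continuous_on_subset[OF solution_onD(6)[OF solb]]) auto
      \<comment> \<open>Its least element is the first time at which \<open>x \<bullet> v\<close>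
        stops being negative; by the intermediate value theorem it is a zero.\<close>
      define Z where "Z = {t \<in> {t1..s0}. 0 \<le> q t}"
      have "compact Z"
      proof -
        have "closed Z" unfolding Z_def by (intro continuous_on_closed_Collect_le[OF _ contq]) auto
        moreover have "bounded Z" by (rule bounded_subset[of "{t1..s0}"]) (auto simp: Z_def)
        ultimately show ?thesis by (simp add: compact_eq_bounded_closed)
      qed
      moreover have "Z \<noteq> {}" using s0 by (auto simp: Z_def)
      ultimately obtain p where p: "p \<in> Z" "\<And>t. t \<in> Z \<Longrightarrow> p \<le> t" using compact_attains_inf by metis
      have p1: "t1 < p" "p \<le> s0" "0 \<le> q p" "p < b"
        using p(1) near(1) s0 by (auto simp: Z_def order_le_less)
      have neg: "q t < 0" if "t1 \<le> t" "t < p" for t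
        using p(2)[of t] that p1 by (force simp: Z_def)
      have qp: "q p = 0"
      proof -
        have "\<exists>x\<ge>t1. x \<le> p \<and> q x = 0"
          by (rule IVT') (use near(1) p1 in \<open>auto intro: continuous_on_subset[OF contq]\<close>)
        then show ?thesis using neg by (metis less_irrefl order_le_less)
      qed
      have f: "norm (fst (\<psi> t)) \<le> norm (fst (\<psi> t1))" "(t - t1) / 2 \<le> q t - q t1" if "t1 \<le> t" "t \<le> p" for t
        by (rule fall[of t]; use that p1 neg in \<open>auto intro: less_imp_le\<close>)+
      have pt: "p - t1 < \<epsilon> / 4" using f(2)[of p] p1 qp near(2) by simp
      define e where "e = sgn (fst (\<psi> p))"
      have e1: "norm e \<le> 1" by (simp add: e_def norm_sgn)
      have kin: "0 < snd (\<psi> t) \<bullet> snd (\<psi> t)"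
        "\<bar>norm (fst (\<psi> t)) * deriv V (norm (fst (\<psi> t)))\<bar> \<le> \<eta> * (snd (\<psi> t) \<bullet> snd (\<psi> t))" if tt: "t1 \<le> t" "t \<le> p" for t
      proof -
        have r: "0 < norm (fst (\<psi> t))" "norm (fst (\<psi> t)) < ra"
          using solution_onD(3)[OF solb, of t] f(1)[OF tt] tt p1 t1' near(3) by auto
        have k: "snd (\<psi> t) \<bullet> snd (\<psi> t) = 2 * (energy V z + V (norm (fst (\<psi> t))))"
          using kinetic_energy[OF solb, of t] tt p1 t1' by simp
        show "0 < snd (\<psi> t) \<bullet> snd (\<psi> t)" using zone(2)[OF r] unfolding k by linarith
        show "\<bar>norm (fst (\<psi> t)) * deriv V (norm (fst (\<psi> t)))\<bar> \<le> \<eta> * (snd (\<psi> t) \<bullet> snd (\<psi> t))"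
          unfolding k by (rule zone(1)[OF r])
      qed
      have turn: "norm (sgn (snd (\<psi> p)) - sgn (snd (\<psi> t1))) \<le> 4 * \<eta>"
        by (rule velocity_turning[OF solb _ _ p1(4) \<eta>(1,2) kin]) (use t1' p1 qp in \<open>auto simp: q_def\<close>)
      have "e \<bullet> sgn (snd (\<psi> p)) = 0" using qp by (simp add: e_def q_def sgn_div_norm)
      \<comment> \<open>As \<open>e\<close> is orthogonal to the velocity at \<open>p\<close>, only
        two errors remain: the deviation of the direction at \<open>t1\<close> from
        \<open>- u\<close>, and the turning between \<open>t1\<close> and \<open>p\<close>.\<close>
      then have "e \<bullet> u = e \<bullet> (sgn (snd (\<psi> t1)) - (- u)) + e \<bullet> (sgn (snd (\<psi> p)) - sgn (snd (\<psi> t1)))"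
        by (simp add: inner_diff_right inner_add_right)
      also have "\<bar>\<dots>\<bar> \<le> norm (sgn (snd (\<psi> t1)) - (- u)) + norm (sgn (snd (\<psi> p)) - sgn (snd (\<psi> t1)))"
      proof -
        have "\<bar>e \<bullet> x\<bar> \<le> norm x" for x
          using Cauchy_Schwarz_ineq2[of e x] mult_right_mono[OF e1, of "norm x"] by simp
        then show ?thesis
          by (intro order_trans[OF abs_triangle_ineq] add_mono) simp_all
      qed
      also have "\<dots> \<le> \<epsilon> / 2 + \<epsilon> / 4"
        using near(5) turn \<eta>(3) by (intro add_mono) (auto simp: dist_norm)
      also have "\<dots> \<le> \<epsilon>" using \<epsilon> by simp
      finally have eu: "\<bar>e \<bullet> u\<bar> \<le> \<epsilon>" .
      have "flow_reaches V z t (reflect e (\<psi> (2 * p - t)))" if "p < t" "t < 2 * p" for t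
        using flow_reaches_past_pericenter[OF solb _ p1(4) _ that] qp p1 t1' by (simp add: q_def e_def)
      moreover have "\<bar>p - T0\<bar> < \<epsilon>" using pt p1 t1 t1' \<epsilon> by auto
      ultimately show ?thesis using e1 eu by (intro exI[of _ p] exI[of _ e]) (auto simp: \<psi>_def)
    qed
  qed
qed

end

section \<open>Continuity of the extended flow and the crossing time\<close>

context smooth_potential
begin

text \<open>The closeness in \<open>solution_nearby\<close> is uniform in time, so continuity of the
  single orbit of \<open>y\<close> in time gives joint continuity. Survival beyond \<open>t\<close>
  is recorded for membership in the flow domain.\<close>

lemma solution_jointly_close:
  assumes \<phi>: "solution_on V y b \<phi>" and s: "0 < s" "s < b" and e: "0 < e"
  obtains \<delta> where "0 < \<delta>" "\<And>z t. dist z y < \<delta> \<Longrightarrow> \<bar>t - s\<bar> < \<delta> \<Longrightarrow>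
    0 < t \<and> (\<exists>c>t. solution_on V z c (Phi V z)) \<and> dist (Phi V z t) (Phi V y s) < e"
proof -
  define c where "c = (s + b) / 2"
  have c: "0 < c" "s < c" "c < b" using s by (auto simp: c_def)
  obtain d1 where d1: "0 < d1" "\<And>z. z \<in> ball y d1 \<Longrightarrow> solution_on V z c (Phi V z)"
    "\<And>z s. z \<in> ball y d1 \<Longrightarrow> 0 \<le> s \<Longrightarrow> s < c \<Longrightarrow> dist (Phi V z s) (Phi V y s) < e / 2"
    using solution_nearby[OF \<phi> c(1,3), of "e / 2"] e by auto
  have "isCont (Phi V y) s"
    using solution_onD(5)[OF solution_on_Phi[OF \<phi>] s] by (rule has_vector_derivative_continuous)
  then obtain d2 where d2: "0 < d2" "\<And>t. dist t s < d2 \<Longrightarrow> dist (Phi V y t) (Phi V y s) < e / 2"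
    using e by (auto simp: continuous_at_eps_delta dest: spec[of _ "e / 2"])
  show ?thesis
  proof (rule that[of "Min {d1, d2, s, c - s}"])
    show "0 < Min {d1, d2, s, c - s}" using d1 d2 s c by simp
    fix z t assume zt: "dist z y < Min {d1, d2, s, c - s}" "\<bar>t - s\<bar> < Min {d1, d2, s, c - s}"
    then have z: "z \<in> ball y d1" and t: "0 < t" "t < c" "dist t s < d2"
      by (auto simp: dist_commute dist_real_def)
    have "dist (Phi V z t) (Phi V y s) < e"
      using dist_triangle[of "Phi V z t" "Phi V y s" "Phi V y t"] d1(3)[OF z, of t] d2(2)[OF t(3)] t by simp
    then show "0 < t \<and> (\<exists>c>t. solution_on V z c (Phi V z)) \<and> dist (Phi V z t) (Phi V y s) < e"
      using d1(2)[OF z] t by blast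
  qed
qed

text \<open>Although the extended flow does not cross \<open>T0\<close> as a solution, its part
  after a collision is a reflected and time-reversed solution and so obeys the same
  equation.\<close>

lemma flow_deriv:
  assumes "0 < t" "flow_reaches V y t z"
  shows "fst (Phi V y t) \<noteq> 0" "(Phi V y has_vector_derivative vector_field V (Phi V y t)) (at t)"
proof -
  consider (regular) b \<phi> where "solution_on V y b \<phi>" "t < b"
    | (collision) T0 \<phi> where "collision_solution V y T0 \<phi>" "T0 < t" "t < 2 * T0"
    using assms(2) unfolding flow_reaches_def by blast
  then have "fst (Phi V y t) \<noteq> 0 \<and> (Phi V y has_vector_derivative vector_field V (Phi V y t)) (at t)"
  proof cases
    case regular
    then have s: "solution_on V y b (Phi V y)" by (intro solution_on_Phi)
    show ?thesis using solution_onD(3)[OF s, of t] solution_onD(5)[OF s, of t] assms regular by simp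
  next
    case collision
    define \<psi> where "\<psi> t = reflect 0 (\<phi> (2 * T0 - t))" for t
    have s: "solution_on V y T0 \<phi>" using collision by (simp add: collision_solution_def)
    have eq: "Phi V y s = \<psi> s" if "s \<in> {T0<..<2 * T0}" for s
      using Phi_collision(2)[OF collision(1), of s] that by (simp add: transmission_eq_reflect \<psi>_def)
    have x: "fst (\<phi> (2 * T0 - t)) \<noteq> 0" using solution_onD(3)[OF s, of "2 * T0 - t"] collision by simp
    have "(\<psi> has_vector_derivative vector_field V (\<psi> t)) (at t)"
      unfolding \<psi>_def using collision by (intro reflect_deriv x solution_onD(5)[OF s]) auto
    then have "(Phi V y has_vector_derivative vector_field V (\<psi> t)) (at t)"
      by (rule has_vector_derivative_transform_within_open[of _ _ _ "{T0<..<2 * T0}"]) (use collision eq in auto)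
    moreover have "fst (\<psi> t) \<noteq> 0" using x by (simp add: \<psi>_def reflect_def)
    ultimately show ?thesis using eq[of t] collision by simp
  qed
  then show "fst (Phi V y t) \<noteq> 0" "(Phi V y has_vector_derivative vector_field V (Phi V y t)) (at t)" by auto
qed

end

definition flow_set :: "(real \<Rightarrow> real) \<Rightarrow> (phase \<times> real) set" where
  "flow_set V = {(y, t). 0 < t \<and> (\<exists>z. flow_reaches V y t z)}"

lemma flow_setI: "0 < t \<Longrightarrow> flow_reaches V y t z \<Longrightarrow> (y, t) \<in> flow_set V"
  unfolding flow_set_def by blast

lemma flow_setE:
  assumes "(y, t) \<in> flow_set V"
  obtains z where "0 < t" "flow_reaches V y t z"
  using assms unfolding flow_set_def by blast

context star_potential
begin

text \<open>\<open>T\<close> is mirrored to the time \<open>s\<close> before the collision, and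
  \<open>t\<close> to \<open>2 * p - t\<close>, which is close to \<open>s\<close>. There the orbits
  are close by ordinary continuity, and the two mirror maps are compared on the radial state of the
  collision orbit.\<close>

lemma flow_continuous_at_collision:
  assumes coll: "collision_solution V y T0 \<phi>" and T: "T0 < T" "T < 2 * T0" and e: "0 < e"
  obtains \<delta> where "0 < \<delta>" "\<And>z t. dist z y < \<delta> \<Longrightarrow> \<bar>t - T\<bar> < \<delta> \<Longrightarrow>
    (z, t) \<in> flow_set V \<and> dist (Phi V z t) (Phi V y T) < e"
proof -
  define s where "s = 2 * T0 - T"
  have sol: "solution_on V y T0 \<phi>" using coll by (simp add: collision_solution_def)
  have s: "0 < s" "s < T0" using T by (auto simp: s_def)
  obtain \<alpha> \<beta> where \<alpha>\<beta>: "Phi V y s = (\<alpha> *\<^sub>R sgn (fst y), \<beta> *\<^sub>R sgn (fst y))"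
    using collision_radial[OF collision_solution_Phi[OF coll], of s] s by (metis less_imp_le prod.collapse)
  define C where "C = 1 + 2 * (\<bar>\<alpha>\<bar> + \<bar>\<beta>\<bar>)"
  have C: "0 < C" by (simp add: C_def)
  obtain d1 where d1: "0 < d1" "\<And>z t. dist z y < d1 \<Longrightarrow> \<bar>t - s\<bar> < d1 \<Longrightarrow>
    0 < t \<and> (\<exists>c>t. solution_on V z c (Phi V z)) \<and> dist (Phi V z t) (Phi V y s) < e / 12"
    using solution_jointly_close[OF sol s, of "e / 12"] e by auto
  \<comment> \<open>The entries serve, in order, for the error from the axis, for the mirrored time
    (off by less than \<open>3 * \<epsilon>\<close>), for \<open>p < t\<close>, and for
    \<open>t < 2 * p\<close>. The tolerance \<open>e / 12\<close> above is multiplied by 6 in the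
    comparison.\<close>
  define \<epsilon> where "\<epsilon> = Min {e / (4 * C), d1 / 4, (T - T0) / 2, s / 4}"
  have \<epsilon>: "0 < \<epsilon>" "\<epsilon> \<le> e / (4 * C)" "\<epsilon> \<le> d1 / 4" "\<epsilon> \<le> (T - T0) / 2" "\<epsilon> \<le> s / 4"
  proof -
    show "0 < \<epsilon>" using e C d1 T s by (simp add: \<epsilon>_def)
  qed (unfold \<epsilon>_def, rule Min_le; simp)+
  obtain d2 where d2: "0 < d2"
    "\<And>z. z \<in> ball y d2 \<Longrightarrow> \<exists>p e. \<bar>p - T0\<bar> < \<epsilon> \<and> norm e \<le> 1 \<and> \<bar>e \<bullet> sgn (fst y)\<bar> \<le> \<epsilon> \<and>
       (\<forall>t. p < t \<and> t < 2 * p \<longrightarrow> flow_reaches V z t (reflect e (Phi V z (2 * p - t))))"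
    using passage[OF coll \<epsilon>(1)] by blast
  show ?thesis
  proof (rule that[of "Min {d1, d2, \<epsilon>}"])
    show "0 < Min {d1, d2, \<epsilon>}" using d1 d2 \<epsilon> by simp
    fix z t assume zt: "dist z y < Min {d1, d2, \<epsilon>}" "\<bar>t - T\<bar> < Min {d1, d2, \<epsilon>}"
    then have z: "dist z y < d1" "z \<in> ball y d2" and t: "\<bar>t - T\<bar> < \<epsilon>" by (auto simp: dist_commute)
    obtain p a where p: "\<bar>p - T0\<bar> < \<epsilon>" and a: "norm a \<le> 1" "\<bar>a \<bullet> sgn (fst y)\<bar> \<le> \<epsilon>"
      and reach: "\<And>t. p < t \<Longrightarrow> t < 2 * p \<Longrightarrow> flow_reaches V z t (reflect a (Phi V z (2 * p - t)))"
      using d2(2)[OF z(2)] by blast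
    have pt: "p < t" "t < 2 * p" "0 < t" "\<bar>2 * p - t - s\<bar> < d1"
      using p t \<epsilon> s T by (auto simp: s_def abs_less_iff)
    have close: "norm (Phi V z (2 * p - t) - Phi V y s) < e / 12"
      using d1(2)[OF z(1) pt(4)] by (simp add: dist_norm)
    have "dist (Phi V z t) (Phi V y T) = norm (reflect a (Phi V z (2 * p - t)) - reflect 0 (Phi V y s))"
      using Phi_eqI[OF reach[OF pt(1,2)]] Phi_collision(2)[OF collision_solution_Phi[OF coll] T]
      by (simp add: dist_norm transmission_eq_reflect s_def)
    also have "\<dots> \<le> 6 * norm (Phi V z (2 * p - t) - Phi V y s) + 2 * (\<bar>\<alpha>\<bar> + \<bar>\<beta>\<bar>) * \<epsilon>"
      unfolding \<alpha>\<beta> by (rule norm_reflect_diff_le[OF a])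
    also have "\<dots> < e / 2 + e / 4"
    proof (rule add_less_le_mono)
      show "6 * norm (Phi V z (2 * p - t) - Phi V y s) < e / 2" using close by simp
      have "2 * (\<bar>\<alpha>\<bar> + \<bar>\<beta>\<bar>) * \<epsilon> \<le> C * \<epsilon>" using \<epsilon>(1) by (intro mult_right_mono) (auto simp: C_def)
      also have "\<dots> \<le> C * (e / (4 * C))" using \<epsilon>(2) C by (intro mult_left_mono) auto
      also have "\<dots> = e / 4" using C by simp
      finally show "2 * (\<bar>\<alpha>\<bar> + \<bar>\<beta>\<bar>) * \<epsilon> \<le> e / 4" .
    qed
    also have "\<dots> < e" using e by simp
    finally show "(z, t) \<in> flow_set V \<and> dist (Phi V z t) (Phi V y T) < e"
      using flow_setI[OF pt(3) reach[OF pt(1,2)]] by simp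
  qed
qed

lemma flow_continuous:
  assumes "(y, T) \<in> flow_set V" "0 < e"
  obtains \<delta> where "0 < \<delta>" "\<And>z t. dist z y < \<delta> \<Longrightarrow> \<bar>t - T\<bar> < \<delta> \<Longrightarrow>
    (z, t) \<in> flow_set V \<and> dist (Phi V z t) (Phi V y T) < e"
proof -
  consider (regular) b \<phi> where "solution_on V y b \<phi>" "T < b"
    | (collision) T0 \<phi> where "collision_solution V y T0 \<phi>" "T0 < T" "T < 2 * T0"
    using assms(1) by (elim flow_setE) (unfold flow_reaches_def, blast)
  then show ?thesis
  proof cases
    case regular
    have "0 < T" using assms(1) by (rule flow_setE)
    then obtain \<delta> where \<delta>: "0 < \<delta>" "\<And>z t. dist z y < \<delta> \<Longrightarrow> \<bar>t - T\<bar> < \<delta> \<Longrightarrow>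
      0 < t \<and> (\<exists>c>t. solution_on V z c (Phi V z)) \<and> dist (Phi V z t) (Phi V y T) < e"
      using solution_jointly_close[OF regular(1) _ regular(2) assms(2)] by metis
    show ?thesis
    proof (rule that[OF \<delta>(1)])
      fix z t assume "dist z y < \<delta>" "\<bar>t - T\<bar> < \<delta>"
      from \<delta>(2)[OF this] obtain c where c: "0 < t" "t < c" "solution_on V z c (Phi V z)"
        "dist (Phi V z t) (Phi V y T) < e" by blast
      then show "(z, t) \<in> flow_set V \<and> dist (Phi V z t) (Phi V y T) < e"
        using flow_setI[OF c(1) Phi_solution(1)[OF c(3)]] by simp
    qed
  next
    case collision
    then show ?thesis using flow_continuous_at_collision[OF collision assms(2)] that by metis
  qed
qed

lemma open_flow_set: "open (flow_set V)"
proof (unfold open_dist, intro ballI)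
  fix w assume "w \<in> flow_set V"
  then obtain y T where w: "w = (y, T)" "(y, T) \<in> flow_set V" by (cases w) auto
  obtain \<delta> where \<delta>: "0 < \<delta>" "\<And>z t. dist z y < \<delta> \<Longrightarrow> \<bar>t - T\<bar> < \<delta> \<Longrightarrow> (z, t) \<in> flow_set V"
    using flow_continuous[OF w(2) zero_less_one] by metis
  have "w' \<in> flow_set V" if "dist w' w < \<delta>" for w'
    using \<delta>(2)[of "fst w'" "snd w'"] that dist_fst_le[of w' w] dist_snd_le[of w' w]
    by (simp add: w(1) dist_real_def)
  then show "\<exists>e>0. \<forall>w'. dist w' w < e \<longrightarrow> w' \<in> flow_set V" using \<delta>(1) by blast
qed

lemma continuous_on_flow: "continuous_on (flow_set V) (\<lambda>(y, t). Phi V y t)"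
proof (unfold continuous_on_iff, intro ballI allI impI)
  fix w e assume w0: "w \<in> flow_set V" and e: "0 < (e::real)"
  then obtain y T where w: "w = (y, T)" "(y, T) \<in> flow_set V" by (cases w) auto
  obtain \<delta> where \<delta>: "0 < \<delta>" "\<And>z t. dist z y < \<delta> \<Longrightarrow> \<bar>t - T\<bar> < \<delta> \<Longrightarrow> dist (Phi V z t) (Phi V y T) < e"
    using flow_continuous[OF w(2) e] by metis
  have "dist (case w' of (y, t) \<Rightarrow> Phi V y t) (case w of (y, t) \<Rightarrow> Phi V y t) < e" if "dist w' w < \<delta>" for w'
    using \<delta>(2)[of "fst w'" "snd w'"] that dist_fst_le[of w' w] dist_snd_le[of w' w]
    by (simp add: w(1) dist_real_def case_prod_beta)
  then show "\<exists>d>0. \<forall>w'\<in>flow_set V. dist w' w < d \<longrightarrow>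
      dist (case w' of (y, t) \<Rightarrow> Phi V y t) (case w of (y, t) \<Rightarrow> Phi V y t) < e"
    using \<delta>(1) by blast
qed

end

text \<open>An implicit function theorem for a parameter in which \<open>g\<close> is merely
  continuous, as the extended flow is only shown to be continuous in its datum. Strict monotonicity
  makes the zero unique, and the opposite signs on its two sides persist for nearby
  parameters.\<close>

lemma continuous_implicit_time:
  fixes g :: "'a::metric_space \<Rightarrow> real \<Rightarrow> real"
  assumes a: "0 < a" and d: "0 < d"
    and cont: "continuous_on (ball y0 d \<times> {T - a..T + a}) (\<lambda>(y, t). g y t)"
    and mono: "\<And>y. y \<in> ball y0 d \<Longrightarrow> strict_mono_on {T - a..T + a} (g y)"
    and zero: "g y0 T = 0"
  obtains \<delta> \<tau> where "0 < \<delta>" "\<delta> \<le> d" "continuous_on (ball y0 \<delta>) \<tau>" "\<tau> y0 = T"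
    "\<forall>y\<in>ball y0 \<delta>. T - a < \<tau> y \<and> \<tau> y < T + a \<and> g y (\<tau> y) = 0"
proof -
  have cont_y: "continuous_on (ball y0 d) (\<lambda>y. g y t)" if "t \<in> {T - a..T + a}" for t
  proof -
    have "continuous_on (ball y0 d) (\<lambda>y. case (y, t) of (y, t) \<Rightarrow> g y t)"
      by (rule continuous_on_compose2[OF cont]) (use that in \<open>auto intro!: continuous_intros\<close>)
    then show ?thesis by simp
  qed
  have cont_t: "continuous_on {T - a..T + a} (g y)" if "y \<in> ball y0 d" for y
  proof -
    have "continuous_on {T - a..T + a} (\<lambda>t. case (y, t) of (y, t) \<Rightarrow> g y t)"
      by (rule continuous_on_compose2[OF cont]) (use that in \<open>auto intro!: continuous_intros\<close>)
    then show ?thesis by simp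
  qed
  have near: "\<exists>e>0. \<forall>y\<in>ball z e. y \<in> ball y0 d \<and> g y s < 0 \<and> 0 < g y t"
    if z: "z \<in> ball y0 d" and st: "s \<in> {T - a..T + a}" "t \<in> {T - a..T + a}" and g: "g z s < 0" "0 < g z t" for z s t
  proof -
    have tend: "((\<lambda>y. g y r) \<longlongrightarrow> g z r) (nhds z)" if "r \<in> {T - a..T + a}" for r
    proof -
      have "isCont (\<lambda>y. g y r) z" using cont_y[OF that] z by (simp add: continuous_on_eq_continuous_at)
      then show ?thesis using tendsto_at_iff_tendsto_nhds[of "\<lambda>y. g y r" z] by (simp add: isCont_def)
    qed
    have "\<forall>\<^sub>F y in nhds z. y \<in> ball y0 d \<and> g y s < 0 \<and> 0 < g y t"
      by (intro eventually_conj eventually_nhds_in_open order_tendstoD(2)[OF tend[OF st(1)] g(1)]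
          order_tendstoD(1)[OF tend[OF st(2)] g(2)]) (use z in auto)
    then show ?thesis by (auto simp: eventually_nhds_metric dist_commute)
  qed
  have y0: "y0 \<in> ball y0 d" using d by simp
  have "g y0 (T - a) < 0" "0 < g y0 (T + a)"
    using strict_mono_onD[OF mono[OF y0], of "T - a" T] strict_mono_onD[OF mono[OF y0], of T "T + a"] a zero by auto
  then obtain \<delta>0 where \<delta>0: "0 < \<delta>0" "\<And>y. y \<in> ball y0 \<delta>0 \<Longrightarrow> y \<in> ball y0 d \<and> g y (T - a) < 0 \<and> 0 < g y (T + a)"
    using near[OF y0, of "T - a" "T + a"] a by auto
  define \<delta> where "\<delta> = min \<delta>0 d"
  have \<delta>: "0 < \<delta>" "\<And>y. y \<in> ball y0 \<delta> \<Longrightarrow> y \<in> ball y0 d" "\<And>y. y \<in> ball y0 \<delta> \<Longrightarrow> g y (T - a) < 0"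
    "\<And>y. y \<in> ball y0 \<delta> \<Longrightarrow> 0 < g y (T + a)"
    using \<delta>0 d by (auto simp: \<delta>_def)
  have "\<exists>t. T - a < t \<and> t < T + a \<and> g y t = 0" if y: "y \<in> ball y0 \<delta>" for y
  proof -
    have "\<exists>t\<ge>T - a. t \<le> T + a \<and> g y t = 0"
      by (rule IVT'[OF _ _ _ cont_t]) (use \<delta>(2-4)[of y] y a in auto)
    then obtain t where t: "T - a \<le> t" "t \<le> T + a" "g y t = 0" by auto
    moreover have "t \<noteq> T - a" "t \<noteq> T + a" using t(3) \<delta>(3,4)[OF y] by auto
    ultimately show ?thesis by (intro exI[of _ t]) auto
  qed
  then obtain \<tau> where \<tau>: "\<And>y. y \<in> ball y0 \<delta> \<Longrightarrow> T - a < \<tau> y \<and> \<tau> y < T + a \<and> g y (\<tau> y) = 0" by metis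
  have less: "t < t'" if "y \<in> ball y0 d" "t \<in> {T - a..T + a}" "t' \<in> {T - a..T + a}" "g y t < g y t'" for y t t'
    using strict_mono_on_less[OF mono[OF that(1)] that(2,3)] that(4) by simp
  show ?thesis
  proof (rule that[OF \<delta>(1)])
    show "\<forall>y\<in>ball y0 \<delta>. T - a < \<tau> y \<and> \<tau> y < T + a \<and> g y (\<tau> y) = 0" using \<tau> by blast
    show "\<delta> \<le> d" by (simp add: \<delta>_def)
    show "\<tau> y0 = T"
      using \<tau>[of y0] \<delta>(1) a zero strict_mono_onD[OF mono[OF y0], of T "\<tau> y0"] strict_mono_onD[OF mono[OF y0], of "\<tau> y0" T]
      by (cases "\<tau> y0" T rule: linorder_cases) auto
    show "continuous_on (ball y0 \<delta>) \<tau>"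
    proof (unfold continuous_on_iff, intro ballI allI impI)
      fix z e assume z: "z \<in> ball y0 \<delta>" and e: "0 < (e::real)"
      \<comment> \<open>A bracket around the zero, shorter than \<open>e\<close> on either side and
        cut off to the interval of monotonicity; the zeros of nearby parameters are trapped in
        it.\<close>
      define s t where "s = max (T - a) (\<tau> z - e / 2)" and "t = min (T + a) (\<tau> z + e / 2)"
      have st: "s \<in> {T - a..T + a}" "t \<in> {T - a..T + a}" "s < \<tau> z" "\<tau> z < t" "\<tau> z - e < s" "t < \<tau> z + e"
        using \<tau>[OF z] e by (auto simp: s_def t_def)
      have \<tau>z: "\<tau> z \<in> {T - a..T + a}" using \<tau>[OF z] by auto
      have "g z s < 0" "0 < g z t"
        using strict_mono_onD[OF mono[OF \<delta>(2)[OF z]] st(1) \<tau>z st(3)] strict_mono_onD[OF mono[OF \<delta>(2)[OF z]] \<tau>z st(2) st(4)] \<tau>[OF z]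
        by auto
      then obtain e' where e': "0 < e'" "\<And>y. y \<in> ball z e' \<Longrightarrow> g y s < 0 \<and> 0 < g y t"
        using near[OF \<delta>(2)[OF z] st(1,2)] by auto
      have "dist (\<tau> y) (\<tau> z) < e" if y: "y \<in> ball y0 \<delta>" "dist y z < e'" for y
      proof -
        have yy: "y \<in> ball y0 d" "\<tau> y \<in> {T - a..T + a}" "g y s < g y (\<tau> y)" "g y (\<tau> y) < g y t"
          using \<delta>(2)[OF y(1)] \<tau>[OF y(1)] e'(2)[of y] y(2) by (auto simp: dist_commute)
        show ?thesis using less[OF yy(1) st(1) yy(2,3)] less[OF yy(1,2) st(2) yy(4)] st by (simp add: dist_real_def)
      qed
      then show "\<exists>d>0. \<forall>y\<in>ball y0 \<delta>. dist y z < d \<longrightarrow> dist (\<tau> y) (\<tau> z) < e" using e'(1) by blast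
    qed
  qed
qed

theorem theorem4:
  fixes V :: "real \<Rightarrow> real" and S Tstar :: ereal and ybar y1 F :: phase and T0 T :: real
    and \<Sigma> :: "phase set"
  assumes "V \<in> V_star_class"
    and "convex_decreasing_up_to V S"
    and "slope_bound_up_to V Tstar"
    and "leads_to_collision V ybar T0"
    and "ereal (norm (fst ybar)) \<le> min Tstar S"
    and "\<And>t. 0 \<le> t \<Longrightarrow> t < T0 \<Longrightarrow> ereal (norm (fst (Phi V ybar t))) \<le> min Tstar S"
    and "T0 < T" and "T < 2 * T0"
    and "y1 = Phi V ybar T"
    and "\<Sigma> = hyperplane y1 F"
    and "transversal_at V y1 F"
  shows "\<exists>\<delta>>0. \<exists>\<tau>. continuous_on (ball ybar \<delta>) \<tau> \<and> \<tau> ybar = T \<and>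
           (\<forall>y\<in>ball ybar \<delta>. (y, \<tau> y) \<in> flow_domain V \<and> Phi V y (\<tau> y) \<in> \<Sigma>) \<and>
           continuous_on (ball ybar \<delta>) (\<lambda>y. Phi V y (\<tau> y))"
proof -
  interpret star_potential V by unfold_locales (rule assms(1))
  obtain \<phi> where coll: "collision_solution V ybar T0 \<phi>"
    using assms(4) by (auto simp: leads_to_collision_def)
  have T: "0 < T" using solution_onD(1)[of ybar T0 \<phi>] coll assms(7) by (simp add: collision_solution_def)
  have mem: "(ybar, T) \<in> flow_set V"
    by (rule flow_setI[OF T Phi_collision(1)[OF coll assms(7,8)]])
  have deriv: "(Phi V y has_vector_derivative vector_field V (Phi V y t)) (at t)" "fst (Phi V y t) \<noteq> 0"
    if "(y, t) \<in> flow_set V" for y t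
    using that flow_deriv[of t y] by (elim flow_setE; blast)+
  \<comment> \<open>This sign makes \<open>g\<close> increase along the flow, in whichever direction
    the hyperplane is crossed.\<close>
  define \<sigma> where "\<sigma> = sgn (vector_field V y1 \<bullet> F)"
  define g where "g y t = \<sigma> * ((Phi V y t - y1) \<bullet> F)" for y t
  define g' where "g' = (\<lambda>(y, t). \<sigma> * (vector_field V (Phi V y t) \<bullet> F))"
  have "continuous_on (flow_set V) g'"
  proof -
    have "continuous_on (flow_set V) (\<lambda>w. vector_field V (case w of (y, t) \<Rightarrow> Phi V y t))"
      by (rule continuous_on_compose2[OF continuous_on_vector_field continuous_on_flow]) (use deriv(2) in auto)
    then show ?thesis unfolding g'_def case_prod_beta by (intro continuous_intros)
  qed
  moreover have "0 < g' (ybar, T)"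
    using assms(11) by (simp add: g'_def \<sigma>_def assms(9)[symmetric] transversal_at_def sgn_if)
  ultimately have "\<forall>\<^sub>F w in nhds (ybar, T). 0 < g' w"
    using open_flow_set mem
    by (intro order_tendstoD(1)[of g' "g' (ybar, T)"])
      (auto simp: continuous_on_eq_continuous_at isCont_def tendsto_at_iff_tendsto_nhds)
  then have "\<forall>\<^sub>F w in nhds (ybar, T). 0 < g' w \<and> w \<in> flow_set V"
    by (intro eventually_conj eventually_nhds_in_open open_flow_set mem)
  then obtain r where r: "0 < r" "\<And>w. dist w (ybar, T) < r \<Longrightarrow> 0 < g' w \<and> w \<in> flow_set V"
    by (auto simp: eventually_nhds_metric)
  \<comment> \<open>Half-width \<open>r / 4\<close> in time and radius \<open>r / 2\<close> in phase
    space keep the box inside the ball of radius \<open>r\<close> on which \<open>g'\<close> is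
    positive.\<close>
  define a where "a = r / 4"
  have a: "0 < a" "a = r / 4" using r by (auto simp: a_def)
  have box: "0 < g' (y, t)" "(y, t) \<in> flow_set V" if "y \<in> ball ybar (r / 2)" "t \<in> {T - a..T + a}" for y t
  proof -
    have "dist (y, t) (ybar, T) \<le> dist y ybar + dist t T"
      unfolding dist_prod_def fst_conv snd_conv by (rule sqrt_sum_squares_le_sum) auto
    also have "\<dots> < r / 2 + r / 2"
    proof (rule add_strict_mono)
      show "dist y ybar < r / 2" using that(1) by (simp add: dist_commute)
      have "\<bar>t - T\<bar> \<le> a" using that(2) by (simp add: abs_le_iff algebra_simps)
      also have "a < r / 2" using r(1) a by simp
      finally show "dist t T < r / 2" by (simp add: dist_real_def)
    qed
    finally show "0 < g' (y, t)" "(y, t) \<in> flow_set V" using r(2) by auto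
  qed
  have dg: "(g y has_real_derivative g' (y, t)) (at t)" if "(y, t) \<in> flow_set V" for y t
  proof -
    have "((\<lambda>t. Phi V y t - y1) has_vector_derivative vector_field V (Phi V y t)) (at t)"
      using has_vector_derivative_diff[OF deriv(1)[OF that] has_vector_derivative_const] by simp
    from DERIV_cmult[OF DERIV_inner[OF this has_vector_derivative_const[of F]], of \<sigma>]
    show ?thesis by (simp add: g_def[abs_def] g'_def)
  qed
  have "continuous_on (ball ybar (r / 2) \<times> {T - a..T + a}) (\<lambda>(y, t). g y t)"
  proof -
    have "continuous_on (ball ybar (r / 2) \<times> {T - a..T + a}) (\<lambda>(y, t). Phi V y t)"
      by (rule continuous_on_subset[OF continuous_on_flow]) (use box(2) in auto)
    then show ?thesis unfolding g_def case_prod_beta by (intro continuous_intros)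
  qed
  moreover have "strict_mono_on {T - a..T + a} (g y)" if "y \<in> ball ybar (r / 2)" for y
  proof (rule strict_mono_onI)
    fix s t assume st: "s \<in> {T - a..T + a}" "t \<in> {T - a..T + a}" "s < t"
    show "g y s < g y t"
    proof (rule DERIV_pos_imp_increasing[OF st(3)])
      fix x assume "s \<le> x" "x \<le> t"
      then have "x \<in> {T - a..T + a}" using st by auto
      from box[OF that this] show "\<exists>d. (g y has_real_derivative d) (at x) \<and> 0 < d"
        using dg by blast
    qed
  qed
  moreover have "g ybar T = 0" by (simp add: g_def assms(9))
  ultimately obtain \<delta> \<tau> where \<delta>: "0 < \<delta>" "\<delta> \<le> r / 2" and \<tau>: "continuous_on (ball ybar \<delta>) \<tau>" "\<tau> ybar = T"
    "\<forall>y\<in>ball ybar \<delta>. T - a < \<tau> y \<and> \<tau> y < T + a \<and> g y (\<tau> y) = 0"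
    by (rule continuous_implicit_time[OF a(1) half_gt_zero[OF r(1)]])
  have in_set: "(y, \<tau> y) \<in> flow_set V" if "y \<in> ball ybar \<delta>" for y
    using bspec[OF \<tau>(3) that] that \<delta> by (intro box(2)) auto
  have \<sigma>: "\<sigma> \<noteq> 0" using assms(11) by (simp add: \<sigma>_def transversal_at_def sgn_zero_iff)
  show ?thesis
  proof (intro exI[of _ \<delta>] exI[of _ \<tau>] conjI ballI \<delta>(1) \<tau>(1,2))
    fix y assume y: "y \<in> ball ybar \<delta>"
    show "(y, \<tau> y) \<in> flow_domain V" using in_set[OF y] unfolding flow_domain_iff by (elim flow_setE) blast
    show "Phi V y (\<tau> y) \<in> \<Sigma>" using bspec[OF \<tau>(3) y] \<sigma> by (simp add: assms(10) hyperplane_def g_def)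
  next
    show "continuous_on (ball ybar \<delta>) (\<lambda>y. Phi V y (\<tau> y))"
    proof -
      have "continuous_on (ball ybar \<delta>) (\<lambda>y. case (y, \<tau> y) of (y, t) \<Rightarrow> Phi V y t)"
        by (rule continuous_on_compose2[OF continuous_on_flow _ image_subsetI[OF in_set]])
          (intro continuous_intros \<tau>(1))
      then show ?thesis by simp
    qed
  qed
qed

end
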